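(* Let $k\geq 2$ be an integer. Let $\mathbf{X}_1,\ldots,\mathbf{X}_m\in\mathbb{C}^{d\times d}$ be positive semidefinite Hermitian matrices of rank at most $k$ such that $\sum_{i=1}^m\mathbf{X}_i\preceq\mathbf{I}_d$. Let $\varepsilon:=\max_{1\leq i\leq m}\operatorname{tr}(\mathbf{X}_i)$. If $\varepsilon\leq\frac{(k-1)^2}{k}$, then \[ \operatorname{maxroot}\ \mu[\mathbf{X}_1,\ldots,\mathbf{X}_m]\leq\left(\sqrt{1-\frac{\varepsilon}{k-1}}+\sqrt{\varepsilon}\right)^2. \]
   Context: For $\mathbf{X}_1,\ldots,\mathbf{X}_m\in\mathbb{C}^{d\times d}$, the mixed characteristic polynomial is \[ \mu[\mathbf{X}_1,\ldots,\mathbf{X}_m](x):=\prod_{i=1}^m(1-\partial_{z_i})\det\Big[x\mathbf{I}_d+\sum_{i=1}^m z_i\mathbf{X}_i\Big]\Big|_{z_1=\cdots=z_m=0}. \] For positive semidefinite Hermitian $\mathbf{X}_i$ this polynomial has only real roots; $\operatorname{maxroot}\,p$ denotes the largest root of a real-rooted polynomial $p$. $\preceq$ is the Loewner order. *)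

theory Defs
  imports "HOL-Analysis.Analysis"
begin

definition hermitian_matrix :: "complex^'n^'n \<Rightarrow> bool" where
  "hermitian_matrix A \<longleftrightarrow> (\<forall>i j. A $ i $ j = cnj (A $ j $ i))"

definition psd_matrix :: "complex^'n^'n \<Rightarrow> bool" where
  "psd_matrix A \<longleftrightarrow> hermitian_matrix A \<and>
     (\<forall>v. 0 \<le> Re (\<Sum>i\<in>UNIV. cnj (v $ i) * (A *v v) $ i))"

definition loewner_le :: "complex^'n^'n \<Rightarrow> complex^'n^'n \<Rightarrow> bool"  (infix "\<preceq>\<^sub>L" 50) where
  "A \<preceq>\<^sub>L B \<longleftrightarrow> psd_matrix (B - A)"

text \<open>The operator \<open>1 - \<partial>\<^bsub>z\<^sub>i\<^esub>\<close> on functions of the complex variables \<open>z\<^sub>1, z\<^sub>2, \<dots>\<close>.\<close>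

definition one_minus_partial ::
    "nat \<Rightarrow> ((nat \<Rightarrow> complex) \<Rightarrow> complex) \<Rightarrow> (nat \<Rightarrow> complex) \<Rightarrow> complex" where
  "one_minus_partial i f = (\<lambda>z. f z - deriv (\<lambda>t. f (z(i := t))) (z i))"

text \<open>The polynomial is represented by its evaluation function. \<open>mat x\<close> is the scalar
  matrix \<open>x I\<close>, and the \<open>foldr\<close> is the composition of the operators for \<open>i = 1, \<dots>, m\<close>
  (which commute on polynomials).\<close>

definition mixed_char_poly :: "nat \<Rightarrow> (nat \<Rightarrow> complex^'n^'n) \<Rightarrow> complex \<Rightarrow> complex" where
  "mixed_char_poly m X x =
     foldr one_minus_partial [1..<Suc m]
       (\<lambda>z. det (mat x + (\<Sum>i=1..m. \<chi> a b. z i * X i $ a $ b))) (\<lambda>_. 0)"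

text \<open>Meaningful for a nonconstant polynomial function all of whose roots are real.\<close>

definition maxroot :: "(complex \<Rightarrow> complex) \<Rightarrow> real" where
  "maxroot p = Max {r. p (complex_of_real r) = 0}"

end

theory Submission
  imports Defs "HOL-Computational_Algebra.Fundamental_Theorem_Algebra"
begin

text \<open>
  With \<open>x\<close> as the variable \<open>z\<^sub>0\<close>, the polynomials
  \<open>\<Prod>(1 - \<partial>\<^sub>i) det (x I + \<Sum> z\<^sub>i X\<^sub>i)\<close> do not vanish for \<open>Im x > 0\<close> and \<open>Im z\<^sub>i \<ge> 0\<close>, which gives
  real roots in \<open>x\<close>. It also makes \<open>\<partial>\<^sub>i f / f\<close>, as a function of \<open>z\<^sub>j\<close>, a rational
  function that maps the upper half plane to the closed lower one, so that it is
  \<open>c + \<Sum>\<^sub>r a\<^sub>r / (z\<^sub>j - r)\<close> with \<open>a\<^sub>r \<ge> 0\<close>, where \<open>r\<close> runs over the at most \<open>k\<close> roots of \<open>f\<close>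
  in \<open>z\<^sub>j\<close>.

  The barrier argument of Marcus, Spielman and Srivastava starts from \<open>z\<^sub>i = - \<delta>\<close> and
  \<open>x = t + \<delta>\<close>, where all barriers \<open>\<partial>\<^sub>i f / f\<close> are at most \<open>\<phi> = \<epsilon> / t\<close>. Applying \<open>1 - \<partial>\<^sub>j\<close> and moving
  \<open>z\<^sub>j\<close> by \<open>\<delta>\<close> does not increase the remaining barriers if, for every root \<open>l\<close>, the sum of
  \<open>1 / (z\<^sub>j + \<delta> - r)\<close> over the other (at most \<open>k - 1\<close>) roots is at most \<open>1 - 1 / \<delta>\<close>; by concavity
  this follows from \<open>\<phi> / (1 + \<delta> \<phi> / (k - 1)) \<le> 1 - 1 / \<delta>\<close>. Hence there is no root beyond
  \<open>(1 + u) (\<epsilon> / u + 1 - \<epsilon> / (k - 1))\<close> for \<open>\<delta> = 1 + u\<close>, \<open>0 < u < k - 1\<close>, and the bound is the value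
  of this expression at its minimum.
\<close>

section \<open>Univariate polynomials\<close>

definition lagrange_basis :: "complex set \<Rightarrow> complex \<Rightarrow> complex poly" where
  "lagrange_basis S a = (\<Prod>b\<in>S - {a}. smult (1 / (a - b)) [:- b, 1:])"

lemma poly_lagrange_basis:
  assumes "finite S" "a \<in> S" "b \<in> S"
  shows "poly (lagrange_basis S a) b = (if a = b then 1 else 0)"
proof (cases "a = b")
  case True
  have "(\<Prod>l\<in>S - {b}. poly (smult (1 / (b - l)) [:- l, 1:]) b) = 1"
    by (rule prod.neutral) (auto simp: diff_divide_distrib[symmetric])
  with True show ?thesis by (simp add: lagrange_basis_def poly_prod)
next
  case False
  with assms show ?thesis
    unfolding lagrange_basis_def poly_prod by (auto intro!: prod_zero bexI[of _ b])
qed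

lemma degree_lagrange_basis:
  assumes "finite S" "a \<in> S"
  shows "degree (lagrange_basis S a) < card S"
proof -
  have "degree (lagrange_basis S a) \<le> (\<Sum>b\<in>S - {a}. 1)"
    unfolding lagrange_basis_def using assms
    by (intro order.trans[OF degree_prod_sum_le] sum_mono) auto
  also have "\<dots> < card S"
    using card_Diff1_less[OF assms] by simp
  finally show ?thesis .
qed

lemma lagrange_interpolation:
  assumes "finite S" "degree p < card S"
  shows "poly p t = (\<Sum>a\<in>S. poly p a * poly (lagrange_basis S a) t)"
proof -
  have "p = (\<Sum>a\<in>S. smult (poly p a) (lagrange_basis S a))"
  proof (rule poly_eqI_degree[where A = S])
    fix x assume x: "x \<in> S"
    have "poly (\<Sum>a\<in>S. smult (poly p a) (lagrange_basis S a)) x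
        = (\<Sum>a\<in>S. if a = x then poly p a else 0)"
      unfolding poly_sum using assms x by (intro sum.cong) (auto simp: poly_lagrange_basis)
    also have "\<dots> = poly p x" using assms x by simp
    finally show "poly p x = poly (\<Sum>a\<in>S. smult (poly p a) (lagrange_basis S a)) x" ..
  next
    show "degree (\<Sum>a\<in>S. smult (poly p a) (lagrange_basis S a)) < card S"
      using assms degree_lagrange_basis[OF assms(1)]
      by (intro degree_sum_less) (auto intro: le_less_trans[OF degree_smult_le])
  qed (use assms in auto)
  then show ?thesis
    by (metis (no_types, lifting) poly_smult poly_sum sum.cong)
qed

section \<open>Logarithmic derivatives and the location of roots\<close>

lemma poly_logderiv:
  fixes p :: "complex poly"
  assumes "poly p t \<noteq> 0"
  shows "poly (pderiv p) t = poly p t * (\<Sum>r\<in>#proots p. 1 / (t - r))"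
proof -
  have "poly (pderiv (\<Prod>r\<in>#A. [:- r, 1:])) t
      = poly (\<Prod>r\<in>#A. [:- r, 1:]) t * (\<Sum>r\<in>#A. 1 / (t - r))"
    if "t \<notin># A" for A :: "complex multiset"
    using that
  proof (induction A)
    case (add x A)
    let ?q = "\<Prod>r\<in>#A. [:- r, 1:]"
    have "poly (pderiv ([:- x, 1:] * ?q)) t = poly ?q t + (t - x) * poly (pderiv ?q) t"
      unfolding pderiv_mult by (simp add: pderiv_pCons algebra_simps)
    also have "\<dots> = (t - x) * poly ?q t * (1 / (t - x) + (\<Sum>r\<in>#A. 1 / (t - r)))"
      using add by (simp add: field_simps)
    also have "(t - x) * poly ?q t = poly ([:- x, 1:] * ?q) t"
      by (simp add: algebra_simps)
    finally show ?case by simp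
  qed auto
  moreover have "t \<notin># proots p" using assms by (cases "p = 0") auto
  moreover define q where "q = (\<Prod>r\<in>#proots p. [:- r, 1:])"
  moreover have "p = smult (lead_coeff p) q"
    unfolding q_def by (rule complex_poly_decompose_multiset[symmetric])
  then have "poly p t = lead_coeff p * poly q t" "poly (pderiv p) t = lead_coeff p * poly (pderiv q) t"
    by (metis poly_smult) (metis \<open>p = smult (lead_coeff p) q\<close> pderiv_smult poly_smult)
  ultimately show ?thesis by simp
qed

lemma Im_inverse_nonpos:
  assumes "Im r \<le> Im t"
  shows "Im (1 / (t - r)) \<le> 0"
  using assms by (simp add: Im_divide divide_le_0_iff)

lemma Im_logderiv_nonpos:
  fixes p :: "complex poly"
  assumes "poly p t \<noteq> 0" "\<And>r. poly p r = 0 \<Longrightarrow> Im r \<le> Im t"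
  shows "Im (poly (pderiv p) t / poly p t) \<le> 0"
proof -
  have "p \<noteq> 0" using assms by auto
  have *: "Im (\<Sum>r\<in>#A. 1 / (t - r)) \<le> 0" if "\<And>r. r \<in># A \<Longrightarrow> Im r \<le> Im t" for A
    using that
  proof (induction A)
    case (add x A)
    then show ?case using Im_inverse_nonpos[of x t] by force
  qed auto
  show ?thesis using poly_logderiv[OF assms(1)] * [of "proots p"] assms \<open>p \<noteq> 0\<close> by simp
qed

text \<open>With all roots strictly below t, the sum of 1 / (t - r) is either empty or has negative
  imaginary part, so it cannot be 1. This is why \<open>1 - d/dz\<close> preserves
  stability.\<close>

lemma poly_minus_pderiv_nonzero:
  fixes p :: "complex poly"
  assumes "poly p t \<noteq> 0" "\<And>r. poly p r = 0 \<Longrightarrow> Im r < Im t"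
  shows "poly p t - poly (pderiv p) t \<noteq> 0"
proof -
  have "p \<noteq> 0" using assms by auto
  have *: "Im (\<Sum>r\<in>#A. 1 / (t - r)) < 0" if "\<And>r. r \<in># A \<Longrightarrow> Im r < Im t" "A \<noteq> {#}" for A
    using that
  proof (induction A)
    case (add x A)
    have "Im (1 / (t - x)) < 0"
      using add.prems(1)[of x] by (simp add: Im_divide divide_less_0_iff sum_power2_gt_zero_iff)
    then show ?case using add by (cases "A = {#}") force+
  qed auto
  have "(\<Sum>r\<in>#proots p. 1 / (t - r)) \<noteq> 1"
  proof (cases "proots p = {#}")
    case False
    then have "Im (\<Sum>r\<in>#proots p. 1 / (t - r)) < 0"
      using \<open>p \<noteq> 0\<close> assms by (intro *) auto
    then show ?thesis by (metis less_irrefl one_complex.sel(2))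
  qed auto
  then show ?thesis using poly_logderiv[OF assms(1)] assms(1) by auto
qed

text \<open>A quantitative substitute for Hurwitz' theorem: it survives pointwise limits of \<open>p\<close>.\<close>

lemma norm_poly_lower_bound:
  fixes p :: "complex poly"
  assumes t: "Im t > 0" and deg: "degree p \<le> n" and roots: "\<And>r. poly p r = 0 \<Longrightarrow> Im r \<le> 0"
  shows "norm (poly p s) \<le> (1 + norm (s - t) / Im t) ^ n * norm (poly p t)"
proof (cases "p = 0")
  case False
  define C where "C = 1 + norm (s - t) / Im t"
  have C: "C \<ge> 1" using t by (simp add: C_def)
  \<comment> \<open>Since Im t <= |t - r|, moving from t to s costs at most |s - t| / Im t in units
    of |t - r|. Multiplied over the roots, this gives a constant that depends on p only through its
    degree.\<close>
  have one: "norm (s - r) \<le> C * norm (t - r)" if "Im r \<le> 0" for r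
  proof -
    have "Im t \<le> norm (t - r)" using abs_Im_le_cmod[of "t - r"] that by simp
    then have "norm (s - t) \<le> norm (s - t) / Im t * norm (t - r)"
      using t mult_left_mono[of "Im t" "norm (t - r)" "norm (s - t)"] by (simp add: field_simps)
    moreover have "norm (s - r) \<le> norm (s - t) + norm (t - r)"
      using norm_triangle_ineq[of "s - t" "t - r"] by simp
    ultimately show ?thesis by (simp add: C_def algebra_simps)
  qed
  have *: "norm (poly (\<Prod>r\<in>#A. [:- r, 1:]) s) \<le> C ^ size A * norm (poly (\<Prod>r\<in>#A. [:- r, 1:]) t)"
    if "\<And>r. r \<in># A \<Longrightarrow> Im r \<le> 0" for A
    using that
  proof (induction A)
    case (add x A)
    have "norm (s - x) * norm (poly (\<Prod>r\<in>#A. [:- r, 1:]) s)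
        \<le> (C * norm (t - x)) * (C ^ size A * norm (poly (\<Prod>r\<in>#A. [:- r, 1:]) t))"
      using add C by (intro mult_mono one) auto
    moreover have "poly (\<Prod>r\<in>#add_mset x A. [:- r, 1:]) y = (y - x) * poly (\<Prod>r\<in>#A. [:- r, 1:]) y" for y
      by (simp add: algebra_simps)
    ultimately show ?case by (simp only: norm_mult size_add_mset power_Suc mult_ac)
  qed auto
  have "norm (poly p s) \<le> C ^ degree p * norm (poly p t)"
  proof -
    have "norm (lead_coeff p) * norm (poly (\<Prod>r\<in>#proots p. [:- r, 1:]) s)
      \<le> norm (lead_coeff p) * (C ^ degree p * norm (poly (\<Prod>r\<in>#proots p. [:- r, 1:]) t))"
      using *[of "proots p"] roots False by (intro mult_left_mono) (auto simp: size_proots_complex)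
    then show ?thesis
      using complex_poly_decompose_multiset[of p]
      by (metis (no_types, lifting) mult.left_commute norm_mult poly_smult)
  qed
  also have "\<dots> \<le> C ^ n * norm (poly p t)"
    using C deg by (intro mult_right_mono power_increasing) auto
  finally show ?thesis by (simp add: C_def)
qed auto

section \<open>Partial fractions of rational Herglotz functions\<close>

text \<open>Approach to a pole z of order n along the ray with direction v: multiplying by s^n > 0
  keeps the sign of the imaginary part and makes the limit finite. Here D is the denominator with
  the pole factor removed.\<close>

lemma Im_ray_limit_nonpos:
  fixes N D :: "complex poly"
  assumes D: "poly D z \<noteq> 0"
    and ev: "\<forall>\<^sub>F s in at_right 0.
      Im (poly N (z + of_real s * v) / ((of_real s * v) ^ n * poly D (z + of_real s * v))) \<le> 0"
  shows "Im (poly N z / poly D z / v ^ n) \<le> 0"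
proof -
  let ?f = "\<lambda>s::real. poly N (z + of_real s * v) / poly D (z + of_real s * v) / v ^ n"
  have "(?f \<longlongrightarrow> poly N (z + of_real 0 * v) / poly D (z + of_real 0 * v) / v ^ n) (at_right 0)"
    unfolding divide_inverse[of _ "v ^ n"]
    by (intro tendsto_intros) (use D in simp)
  then have lim: "((\<lambda>s. Im (?f s)) \<longlongrightarrow> Im (poly N z / poly D z / v ^ n)) (at_right 0)"
    by (auto intro: tendsto_Im)
  have "\<forall>\<^sub>F s in at_right 0. Im (?f s) \<le> 0"
    using ev eventually_at_right_less[of 0]
  proof eventually_elim
    case (elim s)
    have "?f s = of_real (s ^ n) *
        (poly N (z + of_real s * v) / ((of_real s * v) ^ n * poly D (z + of_real s * v)))"
      using elim(2) by (simp add: power_mult_distrib)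
    then have "Im (?f s) = s ^ n *
        Im (poly N (z + of_real s * v) / ((of_real s * v) ^ n * poly D (z + of_real s * v)))"
      by (simp only: Im_complex_of_real Re_complex_of_real times_complex.sel)
    then show ?case using elim by (simp add: mult_nonneg_nonpos)
  qed
  then show ?thesis by (intro tendsto_upperbound[OF lim]) auto
qed

lemma eventually_at_right_not_in_finite:
  fixes x :: real
  assumes "finite E"
  shows "\<forall>\<^sub>F s in at_right 0. x + s \<notin> E"
proof -
  have "\<forall>\<^sub>F y in at x. y \<notin> E"
    using assms by (metis islimpt_finite islimpt_iff_eventually)
  then have "\<forall>\<^sub>F y in at_right x. y \<notin> E" unfolding at_eq_sup_left_right eventually_sup by simp
  then show ?thesis by (simp add: eventually_at_right_to_0[of _ x] add.commute)
qed

text \<open>Finitely many exceptions are allowed on the real line because division by zero yields 0,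
  so cancelling a common root of N and D can alter the value at that point. The sign condition at
  infinity excludes a term - a t with a > 0, which also maps the upper half plane to the lower
  one.\<close>

locale herglotz_quotient =
  fixes N D :: "complex poly"
  assumes D_nz: "D \<noteq> 0"
    and real_roots: "poly D z = 0 \<Longrightarrow> Im z = 0"
    and Im_nonpos: "Im t > 0 \<Longrightarrow> Im (poly N t / poly D t) \<le> 0"
    and real_on_reals: "finite {t::real. Im (poly N (of_real t) / poly D (of_real t)) \<noteq> 0}"
    and eventually_nonneg: "\<forall>\<^sub>F t::real in at_top. 0 \<le> Re (poly N (of_real t) / poly D (of_real t))"
begin

text \<open>Near r the quotient behaves like w / (t - r)^n. As t - r turns through the upper half
  plane, its n-th power sweeps the angles from 0 to n pi, and for n at least 2 the imaginary part
  would have to take both signs.\<close>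

lemma pole_simple:
  assumes D: "D = [:- of_real r, 1:] ^ n * D1" and D1: "poly D1 (of_real r) \<noteq> 0"
    and N: "poly N (of_real r) \<noteq> 0" and n: "n \<ge> 1"
  shows "n = 1" "Im (poly N (of_real r) / poly D1 (of_real r)) = 0"
    "Re (poly N (of_real r) / poly D1 (of_real r)) \<ge> 0"
proof -
  define w where "w = poly N (of_real r) / poly D1 (of_real r)"
  have quot: "poly N (of_real r + y) / poly D (of_real r + y) =
      poly N (of_real r + y) / (y ^ n * poly D1 (of_real r + y))" for y
    by (simp add: D)
  have dir: "Im (w / v ^ n) \<le> 0" if "Im v > 0" for v
    unfolding w_def
  proof (rule Im_ray_limit_nonpos[OF D1])
    show "\<forall>\<^sub>F s in at_right 0. Im (poly N (of_real r + of_real s * v) /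
        ((of_real s * v) ^ n * poly D1 (of_real r + of_real s * v))) \<le> 0"
      using eventually_at_right_less[of 0]
      by eventually_elim (use that in \<open>simp add: Im_nonpos flip: quot\<close>)
  qed
  \<comment> \<open>Approaching r from the right along the real line, with N and with - N, shows
    that w is real.\<close>
  have real0: "\<forall>\<^sub>F s in at_right 0. Im (poly N (of_real (r + s)) / poly D (of_real (r + s))) = 0"
    using eventually_at_right_not_in_finite[OF real_on_reals, of r] by simp
  have "Im (poly N (of_real r) / poly D1 (of_real r) / 1 ^ n) \<le> 0"
  proof (rule Im_ray_limit_nonpos[OF D1])
    show "\<forall>\<^sub>F s in at_right 0. Im (poly N (of_real r + of_real s * 1) /
        ((of_real s * 1) ^ n * poly D1 (of_real r + of_real s * 1))) \<le> 0"
      using real0 by eventually_elim (simp flip: quot)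
  qed
  moreover have "Im (poly (- N) (of_real r) / poly D1 (of_real r) / 1 ^ n) \<le> 0"
  proof (rule Im_ray_limit_nonpos[OF D1])
    show "\<forall>\<^sub>F s in at_right 0. Im (poly (- N) (of_real r + of_real s * 1) /
        ((of_real s * 1) ^ n * poly D1 (of_real r + of_real s * 1))) \<le> 0"
      using real0 by eventually_elim (simp flip: quot)
  qed
  ultimately have Im_w: "Im w = 0" by (simp add: w_def)
  have "w \<noteq> 0" using N D1 by (simp add: w_def)
  \<comment> \<open>The direction is chosen so that its n-th power is i, and Im (w / i) = - Re
    w.\<close>
  have "Re w \<ge> 0"
  proof -
    have "pi / (2 * real n) < pi" using n by (simp add: divide_simps)
    then have "Im (cis (pi / (2 * real n))) > 0" using n by (simp add: sin_gt_zero)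
    then have "Im (w / cis (pi / (2 * real n)) ^ n) \<le> 0" by (rule dir)
    also have "cis (pi / (2 * real n)) ^ n = cis (pi / 2)" using n by (simp add: Complex.DeMoivre)
    also have "\<dots> = \<i>" by simp
    finally show ?thesis by simp
  qed
  \<comment> \<open>The angle 3 pi / (2 n) is below pi as soon as n is at least 2; its direction has
    n-th power - i, which gives the opposite sign and hence w = 0.\<close>
  show "n = 1"
  proof (rule ccontr)
    assume "n \<noteq> 1"
    then have n2: "n \<ge> 2" using n by simp
    then have "3 * pi / (2 * real n) < pi" by (simp add: divide_simps)
    then have "Im (cis (3 * pi / (2 * real n))) > 0" using n by (simp add: sin_gt_zero)
    then have "Im (w / cis (3 * pi / (2 * real n)) ^ n) \<le> 0" by (rule dir)
    also have "cis (3 * pi / (2 * real n)) ^ n = cis (pi + pi / 2)" using n by (simp add: Complex.DeMoivre)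
    also have "\<dots> = cis pi * cis (pi / 2)" by (simp only: cis_mult)
    also have "\<dots> = - \<i>" by simp
    finally have "Re w \<le> 0" by simp
    then show False using \<open>Re w \<ge> 0\<close> Im_w \<open>w \<noteq> 0\<close> by (simp add: complex_eq_iff)
  qed
  show "Im (poly N (of_real r) / poly D1 (of_real r)) = 0"
    "Re (poly N (of_real r) / poly D1 (of_real r)) \<ge> 0"
    using Im_w \<open>Re w \<ge> 0\<close> by (auto simp: w_def)
qed

text \<open>The reflected polynomials turn growth at infinity into a pole at \<open>0\<close>.\<close>

lemma degree_numerator_le: "degree N \<le> degree D"
proof (rule ccontr)
  assume less: "\<not> degree N \<le> degree D"
  define q where "q = degree N - degree D"
  have q: "q \<ge> 1" "degree N = degree D + q" using less by (auto simp: q_def)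
  define w where "w = lead_coeff N / lead_coeff D"
  have D0: "poly (reflect_poly D) 0 \<noteq> 0" using D_nz by simp
  have quot: "poly (reflect_poly N) y / (y ^ q * poly (reflect_poly D) y)
      = poly N (inverse y) / poly D (inverse y)" if "y \<noteq> 0" for y
    using that by (simp add: poly_reflect_poly_nz q power_add)
  have "filterlim (\<lambda>s::real. inverse s) at_top (at_right 0)"
    by (rule filterlim_inverse_at_top_right)
  then have nonneg: "\<forall>\<^sub>F s::real in at_right 0. 0 \<le> Re (poly N (of_real (inverse s)) / poly D (of_real (inverse s)))"
    using eventually_nonneg by (rule eventually_compose_filterlim[rotated])
  have "\<forall>\<^sub>F t::real in at_top. t \<notin> {t::real. Im (poly N (of_real t) / poly D (of_real t)) \<noteq> 0}"
  proof -
    obtain b where b: "\<forall>t\<in>{t::real. Im (poly N (of_real t) / poly D (of_real t)) \<noteq> 0}. t \<le> b"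
      using bdd_above_finite[OF real_on_reals] by (auto simp: bdd_above_def)
    show ?thesis
      using eventually_gt_at_top[of b] by eventually_elim (use b in force)
  qed
  then have real: "\<forall>\<^sub>F s::real in at_right 0. Im (poly N (of_real (inverse s)) / poly D (of_real (inverse s))) = 0"
    using \<open>filterlim (\<lambda>s::real. inverse s) at_top (at_right 0)\<close>
    by (auto dest: eventually_compose_filterlim)
  \<comment> \<open>The factors 1 and - 1 show that w is real; the factor - i turns nonnegativity of
    the real part into a statement on imaginary parts, as Im (- i w) = - Re w.\<close>
  have dir: "Im (poly (smult c (reflect_poly N)) 0 / poly (reflect_poly D) 0 / 1 ^ q) \<le> 0"
    if "c = 1 \<or> c = - 1 \<or> c = - \<i>" for c
  proof (rule Im_ray_limit_nonpos[OF D0])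
    show "\<forall>\<^sub>F s in at_right 0. Im (poly (smult c (reflect_poly N)) (0 + of_real s * 1) /
        ((of_real s * 1) ^ q * poly (reflect_poly D) (0 + of_real s * 1))) \<le> 0"
      using real nonneg eventually_at_right_less[of 0]
    proof eventually_elim
      case (elim s)
      have "poly (smult c (reflect_poly N)) (of_real s) / ((of_real s) ^ q * poly (reflect_poly D) (of_real s))
        = c * (poly N (of_real (inverse s)) / poly D (of_real (inverse s)))"
        using quot[of "of_real s"] elim(3)
        by (simp add: times_divide_eq_right[symmetric] del: times_divide_eq_right)
      moreover have "Im (c * (poly N (of_real (inverse s)) / poly D (of_real (inverse s)))) \<le> 0"
        unfolding times_complex.sel using elim(1,2) that by auto
      ultimately show ?case by simp
    qed
  qed
  have dir': "Im (c * w) \<le> 0" if "c = 1 \<or> c = - 1 \<or> c = - \<i>" for c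
    using dir[OF that] by (simp add: w_def)
  have Im_w: "Im w = 0" and "Re w \<ge> 0"
    using dir'[of 1] dir'[of "-1"] dir'[of "-\<i>"] by auto
  \<comment> \<open>The variable y = s v stands for 1 / t, so v must lie in the lower half plane.
    Its q-th power is - i, and Im (w / - i) = Re w, which forces w = 0.\<close>
  define v where "v = cis (- (pi / (2 * real q)))"
  have "pi / (2 * real q) < pi" using q by (simp add: divide_simps)
  then have Im_v: "Im v < 0" using q by (simp add: v_def sin_gt_zero)
  have "Im (poly (reflect_poly N) 0 / poly (reflect_poly D) 0 / v ^ q) \<le> 0"
  proof (rule Im_ray_limit_nonpos[OF D0])
    show "\<forall>\<^sub>F s in at_right 0. Im (poly (reflect_poly N) (0 + of_real s * v) /
        ((of_real s * v) ^ q * poly (reflect_poly D) (0 + of_real s * v))) \<le> 0"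
      using eventually_at_right_less[of 0]
    proof eventually_elim
      case (elim s)
      have "v \<noteq> 0" using Im_v by auto
      have "Im (inverse (of_real s * v)) > 0"
      proof -
        have "Im (of_real s * v) < 0" using elim Im_v by (simp add: mult_pos_neg)
        moreover have "Im (inverse u) > 0" if "Im u < 0" for u :: complex
          using that by (simp add: divide_neg_pos sum_power2_gt_zero_iff)
        ultimately show ?thesis by blast
      qed
      then have "Im (poly N (inverse (of_real s * v)) / poly D (inverse (of_real s * v))) \<le> 0"
        by (rule Im_nonpos)
      then show ?case using quot[of "of_real s * v"] elim \<open>v \<noteq> 0\<close> by simp
    qed
  qed
  moreover have "v ^ q = - \<i>" using q by (simp add: v_def Complex.DeMoivre complex_eq_iff)
  moreover have "poly (reflect_poly N) 0 / poly (reflect_poly D) 0 = w" by (simp add: w_def)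
  ultimately have "Im (w / - \<i>) \<le> 0" by metis
  then have "Re w \<le> 0" by simp
  then have "w = 0" using Im_w \<open>Re w \<ge> 0\<close> by (simp add: complex_eq_iff)
  then show False using D_nz less by (auto simp: w_def)
qed

end

text \<open>Common roots are cancelled by induction on the degree. In lowest terms all poles are
  simple with nonnegative residues, and after subtraction of the value at infinity, Lagrange
  interpolation of the numerator at the poles is the partial fraction expansion.\<close>

theorem herglotz_partial_fractions:
  assumes "herglotz_quotient N D"
  shows "\<exists>c a. (\<forall>r. 0 \<le> a r) \<and> (\<forall>t. poly D t \<noteq> 0 \<longrightarrow> poly N t / poly D t =
    c + (\<Sum>r | poly D (of_real r) = 0. of_real (a r) / (t - of_real r)))"
  using assms
proof (induction "degree D" arbitrary: N D rule: less_induct)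
  case less
  interpret herglotz_quotient N D by fact
  show ?case
  proof (cases "\<exists>z. poly D z = 0 \<and> poly N z = 0")
    case True
    then obtain z where z: "poly D z = 0" "poly N z = 0" by blast
    obtain r where r: "z = of_real r"
      using real_roots[OF z(1)] that[of "Re z"] by (simp add: complex_eq_iff)
    obtain D1 N1 where D1: "D = [:- z, 1:] * D1" and N1: "N = [:- z, 1:] * N1"
      using z by (auto simp: poly_eq_0_iff_dvd elim!: dvdE)
    have "D1 \<noteq> 0" using D_nz D1 by auto
    then have deg: "degree D1 < degree D" unfolding D1 by (subst degree_mult_eq) auto
    have quot: "poly N t / poly D t = poly N1 t / poly D1 t" if "t \<noteq> z" for t
    proof -
      have "poly N t = (t - z) * poly N1 t" "poly D t = (t - z) * poly D1 t"
        by (simp_all add: N1 D1 algebra_simps)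
      then show ?thesis using that by simp
    qed
    have "herglotz_quotient N1 D1"
    proof
      show "D1 \<noteq> 0" by fact
      show "Im y = 0" if "poly D1 y = 0" for y using that by (intro real_roots) (simp add: D1)
      show "Im (poly N1 t / poly D1 t) \<le> 0" if "Im t > 0" for t
      proof -
        have "t \<noteq> z" using that by (auto simp: r)
        then show ?thesis using Im_nonpos[OF that] quot by simp
      qed
      have "Im (poly N (of_real t) / poly D (of_real t)) \<noteq> 0"
        if "Im (poly N1 (of_real t) / poly D1 (of_real t)) \<noteq> 0" "t \<noteq> r" for t
        using that quot[of "of_real t"] by (simp add: r)
      then have "{t::real. Im (poly N1 (of_real t) / poly D1 (of_real t)) \<noteq> 0}
          \<subseteq> insert r {t. Im (poly N (of_real t) / poly D (of_real t)) \<noteq> 0}"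
        by blast
      then show "finite {t::real. Im (poly N1 (of_real t) / poly D1 (of_real t)) \<noteq> 0}"
        using real_on_reals by (meson finite.insertI finite_subset)
      show "\<forall>\<^sub>F t::real in at_top. 0 \<le> Re (poly N1 (of_real t) / poly D1 (of_real t))"
        using eventually_nonneg eventually_gt_at_top[of r]
      proof eventually_elim
        case (elim t)
        then show ?case using quot[of "of_real t"] by (simp add: r)
      qed
    qed
    from less.hyps[OF deg this] obtain c a where a: "\<And>r. 0 \<le> a r"
      and ca: "\<And>t. poly D1 t \<noteq> 0 \<Longrightarrow> poly N1 t / poly D1 t =
        c + (\<Sum>r | poly D1 (of_real r) = 0. of_real (a r) / (t - of_real r))"
      by blast
    \<comment> \<open>The sum has to run over the roots of D, so the cancelled root gets coefficient
      0 unless it is still a root of \<open>D1\<close>.\<close>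
    define a' where "a' = (\<lambda>r. if poly D1 (of_real r) = 0 then a r else 0)"
    have fin: "finite {r::real. poly D (of_real r) = 0}"
    proof -
      have "{r::real. poly D (of_real r) = 0} \<subseteq> Re ` {z. poly D z = 0}" by force
      then show ?thesis using poly_roots_finite[OF D_nz] finite_surj by blast
    qed
    have "poly N t / poly D t = c + (\<Sum>r | poly D (of_real r) = 0. of_real (a' r) / (t - of_real r))"
      if "poly D t \<noteq> 0" for t
    proof -
      have "t \<noteq> z" "poly D1 t \<noteq> 0" using that z(1) D1 by auto
      then have "poly N t / poly D t
          = c + (\<Sum>r | poly D1 (of_real r) = 0. of_real (a' r) / (t - of_real r))"
        using quot ca by (simp add: a'_def)
      also have "(\<Sum>r | poly D1 (of_real r) = 0. of_real (a' r) / (t - of_real r))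
          = (\<Sum>r | poly D (of_real r) = 0. of_real (a' r) / (t - of_real r))"
        by (intro sum.mono_neutral_left fin) (auto simp: D1 a'_def)
      finally show ?thesis .
    qed
    moreover have "0 \<le> a' r" for r using a by (simp add: a'_def)
    ultimately show ?thesis by blast
  next
    case False
    define S where "S = {z. poly D z = 0}"
    have fin: "finite S" using poly_roots_finite[OF D_nz] by (simp add: S_def)
    \<comment> \<open>\<open>E z t\<close> is D(t) / (t - z) extended to t = z; thus
      \<open>E z z\<close> is the derivative of D at a simple root z, and N(z) /
      \<open>E z z\<close> is the residue.\<close>
    define E where "E z t = lead_coeff D * (\<Prod>b\<in>S - {z}. t - b)" for z t
    have ex: "\<exists>D1. D = [:- z, 1:] ^ order z D * D1 \<and> poly D1 z \<noteq> 0" for z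
      using order_decomp[OF D_nz, of z] by (metis poly_eq_0_iff_dvd)
    have simple: "order z D = 1" if "z \<in> S" for z
    proof -
      obtain r where r: "z = of_real r"
        using real_roots \<open>z \<in> S\<close> that[of "Re z"] by (simp add: complex_eq_iff S_def)
      obtain D1 where "D = [:- z, 1:] ^ order z D * D1" "poly D1 z \<noteq> 0" using ex by blast
      moreover have "order z D \<ge> 1"
        using that order_root[of D z] D_nz by (auto simp: S_def Suc_le_eq)
      ultimately show ?thesis using False that pole_simple(1)[of r "order z D" D1] unfolding r S_def by auto
    qed
    have decomp: "D = smult (lead_coeff D) (\<Prod>z\<in>S. [:- z, 1:])"
    proof -
      have "(\<Prod>z\<in>S. [:- z, 1:] ^ order z D) = (\<Prod>z\<in>S. [:- z, 1:])"
        using simple by (intro prod.cong) auto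
      then show ?thesis using complex_poly_decompose[of D] by (simp add: S_def)
    qed
    have DE: "poly D t = (t - z) * E z t" if "z \<in> S" for z t
      unfolding E_def using fin that
      by (subst decomp) (simp add: poly_prod prod.remove algebra_simps)
    have Epoly: "E z t = poly (smult (lead_coeff D) (\<Prod>b\<in>S - {z}. [:- b, 1:])) t" for z t
      by (simp add: E_def poly_prod)
    have E_nz: "E z z \<noteq> 0" for z using D_nz fin by (simp add: E_def)
    define a where "a r = (if of_real r \<in> S then Re (poly N (of_real r) / E (of_real r) (of_real r)) else 0)" for r
    have residue: "poly N (of_real r) / E (of_real r) (of_real r) = of_real (a r)" "a r \<ge> 0"
      if "of_real r \<in> S" for r
    proof -
      have "D = [:- of_real r, 1:] ^ 1 * smult (lead_coeff D) (\<Prod>b\<in>S - {of_real r}. [:- b, 1:])"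
        using fin that by (subst decomp) (simp add: prod.remove)
      from pole_simple(2,3)[OF this] show "poly N (of_real r) / E (of_real r) (of_real r) = of_real (a r)" "a r \<ge> 0"
        using E_nz[of "of_real r"] False that unfolding Epoly a_def
        by (auto simp: S_def complex_eq_iff simp del: poly_smult)
    qed
    have card: "card S = degree D"
    proof -
      have "degree D = degree (\<Prod>z\<in>S. [:- z, 1:])"
        using D_nz by (subst decomp) simp
      also have "\<dots> = card S" by (subst degree_prod_eq_sum_degree) auto
      finally show ?thesis ..
    qed
    \<comment> \<open>The value of the quotient at infinity, possibly 0.\<close>
    define c where "c = coeff N (degree D) / lead_coeff D"
    define R where "R = N - smult c D"
    \<comment> \<open>The alternative \<open>R = 0\<close> covers constant D, where S is empty and
      no degree is below its cardinality.\<close>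
    have Rdeg: "degree R < card S \<or> R = 0"
    proof -
      have "coeff R (degree D) = 0" using D_nz by (simp add: R_def c_def)
      moreover have "degree R \<le> degree D" unfolding R_def
        using degree_numerator_le by (intro degree_diff_le) auto
      ultimately show ?thesis unfolding card
        by (metis le_neq_implies_less leading_coeff_0_iff)
    qed
    have "poly N t / poly D t = c + (\<Sum>r | poly D (of_real r) = 0. of_real (a r) / (t - of_real r))"
      if t: "poly D t \<noteq> 0" for t
    proof -
      have "poly R t = (\<Sum>z\<in>S. poly N z * poly (lagrange_basis S z) t)"
      proof -
        have "poly R t = (\<Sum>z\<in>S. poly R z * poly (lagrange_basis S z) t)"
          using Rdeg lagrange_interpolation[OF fin] by auto
        \<comment> \<open>R and N agree on S because D vanishes there.\<close>
        also have "\<dots> = (\<Sum>z\<in>S. poly N z * poly (lagrange_basis S z) t)"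
          by (intro sum.cong) (auto simp: R_def S_def)
        finally show ?thesis .
      qed
      also have "\<dots> = (\<Sum>z\<in>S. poly N z / E z z / (t - z) * poly D t)"
      proof (intro sum.cong refl)
        fix z assume z: "z \<in> S"
        have "t \<noteq> z" using z t by (auto simp: S_def)
        have "poly (lagrange_basis S z) t = (\<Prod>b\<in>S - {z}. (t - b) / (z - b))"
          unfolding lagrange_basis_def poly_prod by (simp add: diff_divide_distrib)
        also have "\<dots> = E z t / E z z"
          using D_nz by (simp add: E_def prod_dividef)
        finally show "poly N z * poly (lagrange_basis S z) t = poly N z / E z z / (t - z) * poly D t"
          using \<open>t \<noteq> z\<close> DE[OF z] by simp
      qed
      also have "\<dots> = (\<Sum>z\<in>S. poly N z / E z z / (t - z)) * poly D t"
        by (simp add: sum_distrib_right)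
      also have "(\<Sum>z\<in>S. poly N z / E z z / (t - z))
          = (\<Sum>r | poly D (of_real r) = 0. of_real (a r) / (t - of_real r))"
      proof (rule sum.reindex_bij_witness[of _ of_real Re])
        fix z assume z: "z \<in> S"
        then have *: "of_real (Re z) = z" using real_roots by (simp add: S_def complex_eq_iff)
        then show "of_real (Re z) = z" .
        show "Re z \<in> {r. poly D (of_real r) = 0}" using z * by (simp add: S_def)
        show "of_real (a (Re z)) / (t - of_real (Re z)) = poly N z / E z z / (t - z)"
          using residue(1)[of "Re z"] z * by simp
      qed (auto simp: S_def)
      finally have "poly R t / poly D t
          = (\<Sum>r | poly D (of_real r) = 0. of_real (a r) / (t - of_real r))"
        using t by simp
      moreover have "poly N t / poly D t = c + poly R t / poly D t"
        using t by (simp add: R_def diff_divide_distrib)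
      ultimately show ?thesis by simp
    qed
    moreover have "0 \<le> a r" for r using residue(2) by (cases "of_real r \<in> S") (auto simp: a_def)
    ultimately show ?thesis by blast
  qed
qed

section \<open>Stable polynomials\<close>

definition pdiff :: "nat \<Rightarrow> ((nat \<Rightarrow> complex) \<Rightarrow> complex) \<Rightarrow> (nat \<Rightarrow> complex) \<Rightarrow> complex" where
  "pdiff i f z = deriv (\<lambda>t. f (z(i := t))) (z i)"

lemma one_minus_partial_eq: "one_minus_partial i f z = f z - pdiff i f z"
  by (simp add: one_minus_partial_def pdiff_def)

definition poly_in :: "nat \<Rightarrow> nat \<Rightarrow> ((nat \<Rightarrow> complex) \<Rightarrow> complex) \<Rightarrow> bool" where
  "poly_in j n f \<longleftrightarrow> (\<forall>z. \<exists>p. degree p \<le> n \<and> (\<forall>t. f (z(j := t)) = poly p t))"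

lemma pdiff_section:
  assumes "\<And>t. f (z(i := t)) = poly p t"
  shows "pdiff i f (z(i := t)) = poly (pderiv p) t"
  using assms by (simp add: pdiff_def DERIV_imp_deriv)

lemma poly_inE:
  assumes "poly_in i n f"
  obtains p where "degree p \<le> n" "\<And>t. f (z(i := t)) = poly p t"
    "\<And>t. pdiff i f (z(i := t)) = poly (pderiv p) t"
  using assms pdiff_section unfolding poly_in_def by meson

lemma poly_in_DERIV:
  assumes "poly_in i n f"
  shows "((\<lambda>t. f (z(i := t))) has_field_derivative pdiff i f z) (at (z i))"
proof -
  obtain p where "\<And>t. f (z(i := t)) = poly p t" "\<And>t. pdiff i f (z(i := t)) = poly (pderiv p) t"
    using poly_inE[OF assms] by metis
  then show ?thesis by (metis (no_types, lifting) ext fun_upd_triv poly_DERIV)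
qed

lemma poly_in_continuous:
  assumes "poly_in i n f"
  shows "isCont (\<lambda>t. f (z(i := t))) t"
proof -
  obtain p where "\<And>t. f (z(i := t)) = poly p t"
    using poly_inE[OF assms] by metis
  then show ?thesis by simp
qed

text \<open>Interpolation expresses polynomiality of bounded degree in \<open>z\<^sub>j\<close> as a linear identity,
  which can then be differentiated in the other variables.\<close>

abbreviation nodes :: "nat \<Rightarrow> complex set" where
  "nodes n \<equiv> of_nat ` {..n}"

lemma card_nodes: "card (nodes n) = Suc n"
  by (simp add: card_image inj_on_def)

lemma poly_in_interpolation:
  assumes "poly_in j n f"
  shows "f (z(j := t)) = (\<Sum>a\<in>nodes n. f (z(j := a)) * poly (lagrange_basis (nodes n) a) t)"
proof -
  obtain p where p: "degree p \<le> n" "\<And>t. f (z(j := t)) = poly p t"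
    using poly_inE[OF assms] by metis
  show ?thesis using lagrange_interpolation[of "nodes n" p t] p by (simp add: card_nodes)
qed

lemma pdiff_interpolation:
  assumes "poly_in j n f" "poly_in i m f" "i \<noteq> j"
  shows "pdiff i f (z(j := t)) =
    (\<Sum>a\<in>nodes n. pdiff i f (z(j := a)) * poly (lagrange_basis (nodes n) a) t)"
proof -
  have "((\<lambda>s. f (z(j := t, i := s))) has_field_derivative
      (\<Sum>a\<in>nodes n. pdiff i f (z(j := a)) * poly (lagrange_basis (nodes n) a) t)) (at (z i))"
  proof -
    have eq: "f (z(j := t, i := s))
        = (\<Sum>a\<in>nodes n. f (z(j := a, i := s)) * poly (lagrange_basis (nodes n) a) t)" for s
      using poly_in_interpolation[OF assms(1), of "z(i := s)" t] assms(3)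
      by (simp add: fun_upd_twist)
    have "((\<lambda>s. f (z(j := a, i := s))) has_field_derivative pdiff i f (z(j := a))) (at (z i))" for a
      using poly_in_DERIV[OF assms(2), of "z(j := a)"] assms(3) by simp
    then show ?thesis unfolding eq by (intro DERIV_sum DERIV_cmult_right)
  qed
  then show ?thesis unfolding pdiff_def[of i f "z(j := t)"] using assms(3) DERIV_imp_deriv by simp
qed

lemma poly_in_lincomb:
  assumes "\<And>z t. f (z(j := t)) = (\<Sum>a\<in>nodes n. g z a * poly (lagrange_basis (nodes n) a) t)"
  shows "poly_in j n f"
  unfolding poly_in_def
proof
  fix z
  let ?p = "\<Sum>a\<in>nodes n. smult (g z a) (lagrange_basis (nodes n) a)"
  have "degree ?p \<le> n"
  proof (rule degree_sum_le)
    fix a assume "a \<in> nodes n"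
    then have "degree (lagrange_basis (nodes n) a) < Suc n"
      using degree_lagrange_basis[of "nodes n" a] by (simp add: card_nodes)
    then show "degree (smult (g z a) (lagrange_basis (nodes n) a)) \<le> n"
      using degree_smult_le[of "g z a" "lagrange_basis (nodes n) a"] by linarith
  qed simp
  moreover have "f (z(j := t)) = poly ?p t" for t by (simp add: assms poly_sum)
  ultimately show "\<exists>p. degree p \<le> n \<and> (\<forall>t. f (z(j := t)) = poly p t)" by blast
qed

lemma poly_in_pdiff:
  assumes "poly_in j n f" "poly_in i m f"
  shows "poly_in j n (pdiff i f)"
proof (cases "i = j")
  case True
  show ?thesis unfolding poly_in_def
  proof
    fix z
    obtain p where "degree p \<le> n" "\<And>t. pdiff j f (z(j := t)) = poly (pderiv p) t"
      using poly_inE[OF assms(1)] by metis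
    then show "\<exists>p. degree p \<le> n \<and> (\<forall>t. pdiff i f (z(j := t)) = poly p t)"
      unfolding True by (intro exI[of _ "pderiv p"]) (simp add: degree_pderiv)
  qed
next
  case False
  then show ?thesis by (intro poly_in_lincomb[OF pdiff_interpolation[OF assms]])
qed

lemma poly_in_diff:
  assumes "poly_in j n f" "poly_in j n g"
  shows "poly_in j n (\<lambda>z. f z - g z)"
  unfolding poly_in_def
proof
  fix z
  obtain p where "degree p \<le> n" "\<And>t. f (z(j := t)) = poly p t" using poly_inE[OF assms(1)] by metis
  moreover obtain q where "degree q \<le> n" "\<And>t. g (z(j := t)) = poly q t" using poly_inE[OF assms(2)] by metis
  ultimately show "\<exists>p. degree p \<le> n \<and> (\<forall>t. f (z(j := t)) - g (z(j := t)) = poly p t)"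
    by (intro exI[of _ "p - q"]) (simp add: degree_diff_le)
qed

lemma poly_in_one_minus_partial:
  assumes "poly_in j n f" "poly_in i m f"
  shows "poly_in j n (one_minus_partial i f)"
  unfolding one_minus_partial_eq[abs_def] using assms by (intro poly_in_diff poly_in_pdiff)

text \<open>By interpolation, the derivative in z_j is a finite combination of values at fixed
  nodes, with coefficients that depend on z_j alone. The derivative in z_i passes through such a
  combination.\<close>

lemma pdiff_commute:
  assumes "poly_in j n f" "poly_in i m f" "i \<noteq> j"
  shows "pdiff i (pdiff j f) z = pdiff j (pdiff i f) z"
proof -
  let ?L = "\<lambda>a. poly (pderiv (lagrange_basis (nodes n) a)) (z j)"
  have eq: "pdiff j g y = (\<Sum>a\<in>nodes n. g (y(j := a)) * poly (pderiv (lagrange_basis (nodes n) a)) (y j))"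
    if "poly_in j n g" for g y
  proof -
    have "((\<lambda>t. g (y(j := t))) has_field_derivative
        (\<Sum>a\<in>nodes n. g (y(j := a)) * poly (pderiv (lagrange_basis (nodes n) a)) (y j))) (at (y j))"
      by (subst poly_in_interpolation[OF that]) (intro DERIV_sum DERIV_cmult poly_DERIV)
    then show ?thesis unfolding pdiff_def by (rule DERIV_imp_deriv)
  qed
  have "((\<lambda>s. pdiff j f (z(i := s))) has_field_derivative
      (\<Sum>a\<in>nodes n. pdiff i f (z(j := a)) * ?L a)) (at (z i))"
  proof -
    have "((\<lambda>s. f (z(i := s, j := a))) has_field_derivative pdiff i f (z(j := a))) (at (z i))" for a
      using poly_in_DERIV[OF assms(2), of "z(j := a)"] assms(3) by (simp add: fun_upd_twist)
    then show ?thesis unfolding eq[OF assms(1)] using assms(3)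
      by (simp del: fun_upd_apply) (auto intro!: DERIV_sum DERIV_cmult_right)
  qed
  then have "pdiff i (pdiff j f) z = (\<Sum>a\<in>nodes n. pdiff i f (z(j := a)) * ?L a)"
    unfolding pdiff_def[of i "pdiff j f"] by (rule DERIV_imp_deriv)
  also have "\<dots> = pdiff j (pdiff i f) z"
    by (rule eq[symmetric]) (rule poly_in_pdiff[OF assms(1,2)])
  finally show ?thesis .
qed

text \<open>Commuting with conjugation expresses real coefficients, and K records degree bounds.
  Only z_0 has to be strictly above the real line, since it multiplies the identity while the X_i
  may be singular. The closed condition on the other variables permits the evaluation at z_i =
  0.\<close>

definition stable_poly :: "(nat \<Rightarrow> nat) \<Rightarrow> ((nat \<Rightarrow> complex) \<Rightarrow> complex) \<Rightarrow> bool" where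
  "stable_poly K f \<longleftrightarrow> (\<forall>j. poly_in j (K j) f) \<and> (\<forall>z. f (cnj \<circ> z) = cnj (f z)) \<and>
     (\<forall>z. Im (z 0) > 0 \<longrightarrow> (\<forall>i. Im (z i) \<ge> 0) \<longrightarrow> f z \<noteq> 0)"

lemma stable_polyD:
  assumes "stable_poly K f"
  shows "poly_in j (K j) f" "f (cnj \<circ> z) = cnj (f z)"
    "\<lbrakk>Im (z 0) > 0; \<And>i. Im (z i) \<ge> 0\<rbrakk> \<Longrightarrow> f z \<noteq> 0"
  using assms by (auto simp: stable_poly_def)

lemma pdiff_cnj:
  assumes "poly_in i n f" "\<And>z. f (cnj \<circ> z) = cnj (f z)"
  shows "pdiff i f (cnj \<circ> z) = cnj (pdiff i f z)"
proof -
  have "((\<lambda>t. f ((cnj \<circ> z)(i := t))) has_field_derivative cnj (pdiff i f z)) (at (cnj (z i)))"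
  proof -
    have "((cnj \<circ> (\<lambda>t. f (z(i := t))) \<circ> cnj) has_field_derivative cnj (pdiff i f z)) (at (cnj (z i)))"
      by (intro has_field_derivative_cnj_cnj) (simp add: poly_in_DERIV[OF assms(1)])
    moreover have "cnj \<circ> (\<lambda>t. f (z(i := t))) \<circ> cnj = (\<lambda>t. f ((cnj \<circ> z)(i := t)))"
      by (simp add: fun_eq_iff assms(2)[symmetric] fun_upd_comp)
    ultimately show ?thesis by simp
  qed
  then show ?thesis unfolding pdiff_def[of i f "cnj \<circ> z"] by (simp add: DERIV_imp_deriv)
qed

text \<open>As nonvanishing includes real z_i, all roots of the section in z_i lie strictly in the
  lower half plane, so \<open>poly_minus_pderiv_nonzero\<close> applies.\<close>

lemma stable_poly_one_minus_partial:
  assumes f: "stable_poly K f" and i: "i \<noteq> 0"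
  shows "stable_poly K (one_minus_partial i f)"
  unfolding stable_poly_def
proof (intro conjI allI impI)
  fix j show "poly_in j (K j) (one_minus_partial i f)"
    using stable_polyD(1)[OF f] poly_in_one_minus_partial by blast
next
  fix z show "one_minus_partial i f (cnj \<circ> z) = cnj (one_minus_partial i f z)"
    using pdiff_cnj[OF stable_polyD(1,2)[OF f]] stable_polyD(2)[OF f]
    by (simp add: one_minus_partial_eq)
next
  fix z :: "nat \<Rightarrow> complex"
  assume z: "Im (z 0) > 0" "\<forall>i. Im (z i) \<ge> 0"
  obtain p where p: "\<And>t. f (z(i := t)) = poly p t" "\<And>t. pdiff i f (z(i := t)) = poly (pderiv p) t"
    using poly_inE[OF stable_polyD(1)[OF f, of i]] by metis
  have nz: "poly p t \<noteq> 0" if "Im t \<ge> 0" for t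
    using stable_polyD(3)[OF f, of "z(i := t)"] z i that p(1)[of t] by auto
  then have "poly p (z i) - poly (pderiv p) (z i) \<noteq> 0"
    using z by (intro poly_minus_pderiv_nonzero) (auto simp: not_le[symmetric] intro: order.trans)
  then show "one_minus_partial i f z \<noteq> 0"
    using p(1)[of "z i"] p(2)[of "z i"] by (simp add: one_minus_partial_eq)
qed

section \<open>Stable polynomials at real points\<close>

context
  fixes K f
  assumes f: "stable_poly K f"
begin

lemma stable_real:
  "Im (f (of_real \<circ> w)) = 0" "Im (pdiff i f (of_real \<circ> w)) = 0"
proof -
  have *: "cnj \<circ> (of_real \<circ> w) = of_real \<circ> w" by auto
  show "Im (f (of_real \<circ> w)) = 0"
    using stable_polyD(2)[OF f, of "of_real \<circ> w"] unfolding * by (simp add: complex_eq_iff)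
  show "Im (pdiff i f (of_real \<circ> w)) = 0"
    using pdiff_cnj[OF stable_polyD(1,2)[OF f], of i "of_real \<circ> w"] unfolding *
    by (simp add: complex_eq_iff)
qed

text \<open>Stability says nothing at real z_0, so facts at real points are obtained as limits from
  z_0 + i e with e > 0.\<close>

lemma tendsto_perturb0:
  assumes "poly_in 0 n g"
  shows "((\<lambda>e::real. g (z(0 := z 0 + \<i> * of_real e))) \<longlongrightarrow> g z) (at_right 0)"
proof -
  have "((\<lambda>e::real. z 0 + \<i> * of_real e) \<longlongrightarrow> z 0 + \<i> * of_real 0) (at_right 0)"
    by (intro tendsto_intros)
  then have "((\<lambda>e::real. z 0 + \<i> * of_real e) \<longlongrightarrow> z 0) (at_right 0)" by simp
  from isCont_tendsto_compose[OF poly_in_continuous[OF assms] this, of z] show ?thesis by simp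
qed

text \<open>After perturbing z_0 the section in z_j has no root in the upper half plane, so
  \<open>norm_poly_lower_bound\<close> bounds its value at w j by C times its value at t. C is
  independent of the perturbation, so in the limit a zero at t would force a zero at w.\<close>

lemma real_rooted_section_upper:
  assumes w: "f (of_real \<circ> w) \<noteq> 0" and j: "j \<noteq> 0" and t: "Im t > 0"
  shows "f ((of_real \<circ> w)(j := t)) \<noteq> 0"
proof
  assume zero: "f ((of_real \<circ> w)(j := t)) = 0"
  define z where "z = (complex_of_real \<circ> w)"
  define C where "C = (1 + norm (z j - t) / Im t) ^ K j"
  have bound: "norm (f (z(0 := z 0 + \<i> * of_real e)))
      \<le> C * norm (f ((z(j := t))(0 := (z(j := t)) 0 + \<i> * of_real e)))" if "e > 0" for e
  proof -
    define y where "y = z(0 := z 0 + \<i> * of_real e)"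
    obtain p where p: "degree p \<le> K j" "\<And>t. f (y(j := t)) = poly p t"
      using poly_inE[OF stable_polyD(1)[OF f, of j]] by metis
    have "Im r \<le> 0" if "poly p r = 0" for r
      using stable_polyD(3)[OF f, of "y(j := r)"] p(2)[of r] that j \<open>e > 0\<close>
      by (force simp: y_def z_def)
    then have "norm (poly p (z j)) \<le> C * norm (poly p t)"
      unfolding C_def by (intro norm_poly_lower_bound t p)
    moreover have "y(j := z j) = y" using j by (auto simp: y_def)
    moreover have "y(j := t) = (z(j := t))(0 := (z(j := t)) 0 + \<i> * of_real e)"
      using j by (auto simp: y_def)
    ultimately show ?thesis using p(2)[of "z j"] p(2)[of t] by (simp add: y_def)
  qed
  have "norm (f z) \<le> C * norm (f (z(j := t)))"
  proof (rule tendsto_le)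
    show "((\<lambda>e. C * norm (f ((z(j := t))(0 := (z(j := t)) 0 + \<i> * of_real e)))) \<longlongrightarrow> C * norm (f (z(j := t)))) (at_right 0)"
      by (intro tendsto_intros tendsto_perturb0[OF stable_polyD(1)[OF f]])
    show "((\<lambda>e. norm (f (z(0 := z 0 + \<i> * of_real e)))) \<longlongrightarrow> norm (f z)) (at_right 0)"
      by (intro tendsto_intros tendsto_perturb0[OF stable_polyD(1)[OF f]])
    show "\<forall>\<^sub>F e in at_right 0. norm (f (z(0 := z 0 + \<i> * of_real e)))
      \<le> C * norm (f ((z(j := t))(0 := (z(j := t)) 0 + \<i> * of_real e)))"
      using eventually_at_right_less[of 0] by eventually_elim (rule bound)
  qed simp
  then show False using zero w by (simp add: z_def)
qed

lemma real_rooted_section: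
  assumes w: "f (of_real \<circ> w) \<noteq> 0" and j: "j \<noteq> 0" and t: "f ((of_real \<circ> w)(j := t)) = 0"
  shows "Im t = 0"
proof (rule ccontr)
  assume "Im t \<noteq> 0"
  moreover have "cnj \<circ> ((of_real \<circ> w)(j := t)) = (of_real \<circ> w)(j := cnj t)" by auto
  then have "f ((of_real \<circ> w)(j := cnj t)) = 0"
    using stable_polyD(2)[OF f, of "(of_real \<circ> w)(j := t)"] t by simp
  ultimately show False
    using real_rooted_section_upper[OF w j, of t] real_rooted_section_upper[OF w j, of "cnj t"] t
    by (cases "Im t > 0") auto
qed

text \<open>For perturbed z_0 and z_j = t the section in z_i has its roots in the lower half plane,
  while z_i itself is real; \<open>Im_logderiv_nonpos\<close> then gives the sign, which survives
  the limit.\<close>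

lemma Im_logderiv_section_nonpos:
  assumes w: "f (of_real \<circ> w) \<noteq> 0" and ij: "i \<noteq> 0" "j \<noteq> 0" "i \<noteq> j" and t: "Im t > 0"
  shows "Im (pdiff i f ((of_real \<circ> w)(j := t)) / f ((of_real \<circ> w)(j := t))) \<le> 0"
proof -
  define z where "z = (complex_of_real \<circ> w)(j := t)"
  have z: "Im (z l) \<ge> 0" "Im (z i) = 0" for l using ij t by (auto simp: z_def)
  have nz: "f z \<noteq> 0" unfolding z_def by (rule real_rooted_section_upper[OF w ij(2) t])
  have ev: "Im (pdiff i f (z(0 := z 0 + \<i> * of_real e)) / f (z(0 := z 0 + \<i> * of_real e))) \<le> 0"
    if "e > 0" for e
  proof -
    define y where "y = z(0 := z 0 + \<i> * of_real e)"
    have y: "Im (y l) \<ge> 0" "Im (y 0) > 0" "Im (y i) = 0" for l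
      using z(1)[of l] z(2) z(1)[of 0] ij that by (auto simp: y_def)
    obtain p where p: "\<And>t. f (y(i := t)) = poly p t" "\<And>t. pdiff i f (y(i := t)) = poly (pderiv p) t"
      using poly_inE[OF stable_polyD(1)[OF f, of i]] by metis
    have nz: "poly p s \<noteq> 0" if "Im s \<ge> 0" for s
      using stable_polyD(3)[OF f, of "y(i := s)"] p(1)[of s] that ij y by auto
    then have "Im (poly (pderiv p) (y i) / poly p (y i)) \<le> 0"
      using y by (intro Im_logderiv_nonpos) (auto simp: not_le[symmetric] intro: order.trans)
    then show ?thesis using p(1)[of "y i"] p(2)[of "y i"] by (simp flip: y_def)
  qed
  have "((\<lambda>e. Im (pdiff i f (z(0 := z 0 + \<i> * of_real e)) / f (z(0 := z 0 + \<i> * of_real e))))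
      \<longlongrightarrow> Im (pdiff i f z / f z)) (at_right 0)"
    by (intro tendsto_intros nz tendsto_perturb0[OF stable_polyD(1)[OF f]]
        tendsto_perturb0[OF poly_in_pdiff[OF stable_polyD(1)[OF f] stable_polyD(1)[OF f]]])
  then have "Im (pdiff i f z / f z) \<le> 0"
    by (rule tendsto_upperbound)
      (use eventually_at_right_less[of 0] in \<open>auto elim!: eventually_mono intro: ev\<close>)
  then show ?thesis by (simp add: z_def)
qed

end

section \<open>Shifting the barrier\<close>

text \<open>Jensen's inequality for the concave map x / (1 + \<delta> x). The tangent at the mean
  \<phi> / n has nonnegative intercept, so having fewer than n entries is harmless.\<close>

lemma sum_mset_concave_bound:
  fixes A :: "real multiset"
  assumes "\<And>x. x \<in># A \<Longrightarrow> 0 \<le> x" "size A \<le> n" "n \<ge> 1" "(\<Sum>x\<in>#A. x) \<le> \<phi>" "\<delta> > 0" "\<phi> \<ge> 0"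
  shows "(\<Sum>x\<in>#A. x / (1 + \<delta> * x)) \<le> \<phi> / (1 + \<delta> * \<phi> / real n)"
proof -
  define a where "a = \<phi> / real n"
  have a: "a \<ge> 0" "real n * a = \<phi>" using assms by (auto simp: a_def)
  have pos: "1 + \<delta> * a > 0" using a assms by (simp add: add_pos_nonneg)
  \<comment> \<open>the tangent line at \<open>a\<close>\<close>
  have tangent: "x / (1 + \<delta> * x) \<le> (\<delta> * a\<^sup>2 + x) / (1 + \<delta> * a)\<^sup>2" if "x \<ge> 0" for x
  proof -
    have px: "1 + \<delta> * x > 0" using that assms by (simp add: add_pos_nonneg)
    have "(\<delta> * a\<^sup>2 + x) * (1 + \<delta> * x) - x * (1 + \<delta> * a)\<^sup>2 = \<delta> * (a - x)\<^sup>2"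
      by (simp add: power2_eq_square algebra_simps)
    also have "\<dots> \<ge> 0" using assms by simp
    finally show ?thesis using px pos by (simp add: divide_simps)
  qed
  have "(\<Sum>x\<in>#A. x / (1 + \<delta> * x)) \<le> (\<Sum>x\<in>#A. (\<delta> * a\<^sup>2 + x) / (1 + \<delta> * a)\<^sup>2)"
    using tangent assms(1) by (intro sum_mset_mono) auto
  also have "\<dots> = (real (size A) * (\<delta> * a\<^sup>2) + (\<Sum>x\<in>#A. x)) / (1 + \<delta> * a)\<^sup>2"
    by (induction A) (auto simp: add_divide_distrib algebra_simps)
  also have "\<dots> \<le> (real n * (\<delta> * a\<^sup>2) + \<phi>) / (1 + \<delta> * a)\<^sup>2"
    using assms by (intro divide_right_mono add_mono mult_right_mono) auto
  also have "real n * (\<delta> * a\<^sup>2) + \<phi> = \<phi> * (1 + \<delta> * a)"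
    using a(2) by (simp add: power2_eq_square algebra_simps)
  also have "\<phi> * (1 + \<delta> * a) / (1 + \<delta> * a)\<^sup>2 = \<phi> / (1 + \<delta> * a)"
    using pos by (simp add: power2_eq_square)
  finally show ?thesis by (simp add: a_def)
qed

lemma sum_mset_image_nonneg:
  fixes g :: "'a \<Rightarrow> real"
  assumes "\<And>x. x \<in># A \<Longrightarrow> 0 \<le> g x"
  shows "0 \<le> (\<Sum>x\<in>#A. g x)"
  using assms by (induction A) auto

text \<open>One root l is split off, so at most k - 1 others remain; this is the source of k - 1 in
  the final bound. With x = 1 / (y - r), the shifted term 1 / (y + \<delta> - r) is x / (1 +
  \<delta> x), to which concavity applies.\<close>

lemma shifted_root_sum_bound:
  fixes A :: "real multiset"
  assumes A: "\<And>r. r \<in># A \<Longrightarrow> r < y" "size A \<le> k" and k: "k \<ge> 2"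
    and sum: "(\<Sum>r\<in>#A. 1 / (y - r)) \<le> \<phi>" and \<delta>: "\<delta> > 0"
    and cond: "\<phi> / (1 + \<delta> * \<phi> / (real k - 1)) \<le> 1 - 1 / \<delta>" and l: "l \<in># A"
  shows "(\<Sum>r\<in>#A. 1 / (y + \<delta> - r)) \<le> 1 - 1 / \<delta> + 1 / (y + \<delta> - l)"
proof -
  obtain B where B: "A = add_mset l B" using l by (metis insert_DiffM)
  let ?B = "image_mset (\<lambda>r. 1 / (y - r)) B"
  have nonneg: "(\<Sum>r\<in>#C. 1 / (y - r)) \<ge> 0" if "C \<subseteq># A" for C
  proof (rule sum_mset_image_nonneg)
    fix r assume "r \<in># C"
    then have "r < y" using A(1) that by (meson mset_subset_eqD)
    then show "0 \<le> 1 / (y - r)" by simp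
  qed
  have "\<phi> \<ge> 0" using nonneg[of A] sum by simp
  have "(\<Sum>x\<in>#?B. x / (1 + \<delta> * x)) \<le> \<phi> / (1 + \<delta> * \<phi> / real (k - 1))"
  proof (rule sum_mset_concave_bound)
    show "0 \<le> x" if "x \<in># ?B" for x using that A(1) B by (auto simp: less_imp_le)
    show "size ?B \<le> k - 1" using A(2) B by simp
    show "(\<Sum>x\<in>#?B. x) \<le> \<phi>" using sum A(1)[of l] B
      by (simp add: image_mset.comp) (smt (verit) divide_pos_pos)
  qed (use k \<delta> \<open>\<phi> \<ge> 0\<close> in auto)
  also have "\<dots> \<le> 1 - 1 / \<delta>" using cond k by (simp add: of_nat_diff)
  also have "(\<Sum>x\<in>#?B. x / (1 + \<delta> * x)) = (\<Sum>r\<in>#B. 1 / (y + \<delta> - r))"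
  proof -
    have "1 / (y - r) / (1 + \<delta> * (1 / (y - r))) = 1 / (y + \<delta> - r)" if "r \<in># B" for r
    proof -
      have "y - r > 0" using A(1)[of r] B that by simp
      then show ?thesis by (simp add: divide_simps)
    qed
    then show ?thesis by (simp add: image_mset.compositionality comp_def cong: image_mset_cong)
  qed
  finally show ?thesis by (simp add: B)
qed

section \<open>Behaviour of the barriers of a stable polynomial\<close>

context
  fixes K f
  assumes f: "stable_poly K f"
begin

lemma real_logderiv:
  assumes nz: "f (of_real \<circ> w) \<noteq> 0" and i: "i \<noteq> 0"
  obtains A :: "real multiset" where "size A \<le> K i"
    "set_mset A = {r. f ((of_real \<circ> w)(i := of_real r)) = 0}"
    "\<And>t. f ((of_real \<circ> w)(i := t)) \<noteq> 0 \<Longrightarrow>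
      pdiff i f ((of_real \<circ> w)(i := t)) = f ((of_real \<circ> w)(i := t)) * (\<Sum>r\<in>#A. 1 / (t - of_real r))"
proof -
  obtain p where p: "degree p \<le> K i" "\<And>t. f ((of_real \<circ> w)(i := t)) = poly p t"
    "\<And>t. pdiff i f ((of_real \<circ> w)(i := t)) = poly (pderiv p) t"
    using poly_inE[OF stable_polyD(1)[OF f, of i]] by metis
  have "p \<noteq> 0" using p(2)[of "of_real (w i)"] nz by (auto simp: fun_upd_comp[symmetric])
  have real: "of_real (Re r) = r" if "poly p r = 0" for r
  proof -
    have "f ((of_real \<circ> w)(i := r)) = 0" using p(2) that by simp
    then have "Im r = 0" by (rule real_rooted_section[OF f nz i])
    then show ?thesis by (simp add: complex_eq_iff)
  qed
  define A where "A = image_mset Re (proots p)"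
  have A: "image_mset of_real A = proots p"
  proof -
    have "image_mset (\<lambda>r. of_real (Re r)) (proots p) = image_mset (\<lambda>r. r) (proots p)"
      using real \<open>p \<noteq> 0\<close> by (intro image_mset_cong) auto
    then show ?thesis by (simp add: A_def image_mset.compositionality comp_def)
  qed
  show ?thesis
  proof
    show "size A \<le> K i" using p(1) by (simp add: A_def size_proots_complex)
    have "set_mset A = {r. of_real r \<in># proots p}" unfolding A[symmetric] by auto
    then show "set_mset A = {r. f ((of_real \<circ> w)(i := of_real r)) = 0}"
      using \<open>p \<noteq> 0\<close> p(2) by simp
    fix t assume "f ((of_real \<circ> w)(i := t)) \<noteq> 0"
    then show "pdiff i f ((of_real \<circ> w)(i := t))
        = f ((of_real \<circ> w)(i := t)) * (\<Sum>r\<in>#A. 1 / (t - of_real r))"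
      using poly_logderiv[of p t] p by (simp add: A[symmetric] image_mset.compositionality comp_def)
  qed
qed

text \<open>All roots in z_i lie below w i, so every term 1 / (w i - r) is positive. This supplies
  the sign at infinity that \<open>herglotz_quotient\<close> asks for.\<close>

lemma logderiv_nonneg:
  assumes above: "\<And>t. t \<ge> w i \<Longrightarrow> f ((of_real \<circ> w)(i := of_real t)) \<noteq> 0" and i: "i \<noteq> 0"
  shows "Re (pdiff i f (of_real \<circ> w) / f (of_real \<circ> w)) \<ge> 0"
proof -
  have upd: "(complex_of_real \<circ> w)(i := of_real (w i)) = (of_real \<circ> w)" by auto
  have nz: "f (of_real \<circ> w) \<noteq> 0" using above[of "w i"] upd by simp
  obtain A :: "real multiset" where
    A: "set_mset A = {r. f ((of_real \<circ> w)(i := of_real r)) = 0}"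
      "pdiff i f (of_real \<circ> w) = f (of_real \<circ> w) * (\<Sum>r\<in>#A. 1 / (of_real (w i) - of_real r))"
    using real_logderiv[OF nz i] upd nz by metis
  have "(\<Sum>r\<in>#A. 1 / (complex_of_real (w i) - of_real r)) = of_real (\<Sum>r\<in>#A. 1 / (w i - r))"
    by (induction A) auto
  moreover have "(\<Sum>r\<in>#A. 1 / (w i - r)) \<ge> 0"
  proof (intro sum_mset_image_nonneg)
    fix r assume "r \<in># A"
    then have "r < w i" using A(1) above[of r] by force
    then show "1 / (w i - r) \<ge> 0" by simp
  qed
  ultimately show ?thesis using A(2) nz by simp
qed

lemma logderiv_partial_fractions:
  assumes ij: "i \<noteq> 0" "j \<noteq> 0" "i \<noteq> j"
    and above: "\<And>s t. \<lbrakk>s \<ge> w i; t \<ge> w j\<rbrakk> \<Longrightarrow> f (of_real \<circ> w(i := s, j := t)) \<noteq> 0"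
  shows "\<exists>a c. (\<forall>r. (0::real) \<le> a r) \<and> (\<forall>t. f ((of_real \<circ> w)(j := t)) \<noteq> 0 \<longrightarrow>
      pdiff i f ((of_real \<circ> w)(j := t)) / f ((of_real \<circ> w)(j := t)) =
      c + (\<Sum>r | f ((of_real \<circ> w)(j := of_real r)) = 0. of_real (a r) / (t - of_real r)))"
proof -
  have nz: "f (of_real \<circ> w) \<noteq> 0" using above[of "w i" "w j"] by simp
  obtain D where D: "\<And>t. f ((of_real \<circ> w)(j := t)) = poly D t"
    using poly_inE[OF stable_polyD(1)[OF f, of j]] by metis
  obtain N where N: "\<And>t. pdiff i f ((of_real \<circ> w)(j := t)) = poly N t"
    using poly_inE[OF poly_in_pdiff[OF stable_polyD(1)[OF f, of j] stable_polyD(1)[OF f, of i]]] by metis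
  have "herglotz_quotient N D"
  proof
    show "D \<noteq> 0" using D[of "of_real (w j)"] nz by (auto simp: fun_upd_comp[symmetric])
    show "Im z = 0" if "poly D z = 0" for z
    proof -
      have "f ((of_real \<circ> w)(j := z)) = 0" using D that by simp
      then show ?thesis by (rule real_rooted_section[OF f nz ij(2)])
    qed
    show "Im (poly N t / poly D t) \<le> 0" if "Im t > 0" for t
    proof -
      have "Im (pdiff i f ((of_real \<circ> w)(j := t)) / f ((of_real \<circ> w)(j := t))) \<le> 0"
        by (rule Im_logderiv_section_nonpos[OF f nz ij that])
      then show ?thesis by (simp add: D N)
    qed
    have "Im (poly N (of_real t) / poly D (of_real t)) = 0" for t
      using stable_real(1)[OF f, where w = "w(j := t)"] stable_real(2)[OF f, where w = "w(j := t)" and i = i]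
      unfolding D[symmetric] N[symmetric] fun_upd_comp by (simp add: Im_divide)
    then show "finite {t. Im (poly N (of_real t) / poly D (of_real t)) \<noteq> 0}" by simp
    show "\<forall>\<^sub>F t in at_top. 0 \<le> Re (poly N (of_real t) / poly D (of_real t))"
      using eventually_ge_at_top[of "w j"]
    proof eventually_elim
      case (elim t)
      have "Re (pdiff i f (of_real \<circ> w(j := t)) / f (of_real \<circ> w(j := t))) \<ge> 0"
        using above elim ij by (intro logderiv_nonneg) (auto simp: fun_upd_comp fun_upd_twist)
      then show ?case unfolding D[symmetric] N[symmetric] fun_upd_comp .
    qed
  qed
  from herglotz_partial_fractions[OF this] show ?thesis
    unfolding D[symmetric] N[symmetric] by blast
qed

text \<open>In the partial fraction expansion all poles lie below w j, and each a_r / (t - r) with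
  a_r >= 0 decreases to the right of its pole.\<close>

lemma logderiv_antimono:
  assumes ij: "i \<noteq> 0" "j \<noteq> 0" "i \<noteq> j" and \<delta>: "\<delta> \<ge> 0"
    and above: "\<And>s t. \<lbrakk>s \<ge> w i; t \<ge> w j\<rbrakk> \<Longrightarrow> f (of_real \<circ> w(i := s, j := t)) \<noteq> 0"
  shows "Re (pdiff i f (of_real \<circ> w(j := w j + \<delta>)) / f (of_real \<circ> w(j := w j + \<delta>)))
    \<le> Re (pdiff i f (of_real \<circ> w) / f (of_real \<circ> w))"
proof -
  obtain a c where a: "\<And>r. a r \<ge> (0::real)"
    and pf: "\<And>t. f ((of_real \<circ> w)(j := t)) \<noteq> 0 \<Longrightarrow>
      pdiff i f ((of_real \<circ> w)(j := t)) / f ((of_real \<circ> w)(j := t)) =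
      c + (\<Sum>r | f ((of_real \<circ> w)(j := of_real r)) = 0. of_real (a r) / (t - of_real r))"
    using logderiv_partial_fractions[OF ij above] by blast
  have nz: "f ((of_real \<circ> w)(j := of_real t)) \<noteq> 0" if "t \<ge> w j" for t
    using above[of "w i" t] that ij by (simp add: fun_upd_comp)
  have val: "Re (pdiff i f (of_real \<circ> w(j := t)) / f (of_real \<circ> w(j := t)))
      = Re c + (\<Sum>r | f ((of_real \<circ> w)(j := of_real r)) = 0. a r / (t - r))" if "t \<ge> w j" for t
    using arg_cong[OF pf[OF nz[OF that]], of Re] by (simp add: fun_upd_comp flip: of_real_diff of_real_divide)
  have "(\<Sum>r | f ((of_real \<circ> w)(j := of_real r)) = 0. a r / (w j + \<delta> - r))
      \<le> (\<Sum>r | f ((of_real \<circ> w)(j := of_real r)) = 0. a r / (w j - r))"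
  proof (rule sum_mono)
    fix r assume "r \<in> {r. f ((of_real \<circ> w)(j := of_real r)) = 0}"
    then have "r < w j" using nz by (force simp: not_le[symmetric])
    then show "a r / (w j + \<delta> - r) \<le> a r / (w j - r)"
      using a \<delta> by (intro divide_left_mono) auto
  qed
  then show ?thesis using val[of "w j + \<delta>"] val[of "w j"] \<delta> by simp
qed

text \<open>Here s is the logarithmic derivative of f in z_j at the shifted point. It is below 1
  because 1 / (w j + \<delta> - l) < 1 / \<delta> for every root l. The bound for each single root
  is the form that the termwise comparison in \<open>barrier_shift_le\<close> needs.\<close>

lemma barrier_shift_roots:
  assumes j: "j \<noteq> 0" and k: "k \<ge> 2" "K j \<le> k" and \<delta>: "\<delta> > 0"
    and above: "\<And>t. t \<ge> w j \<Longrightarrow> f ((of_real \<circ> w)(j := of_real t)) \<noteq> 0"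
    and bound: "Re (pdiff j f (of_real \<circ> w) / f (of_real \<circ> w)) \<le> \<phi>"
    and cond: "\<phi> / (1 + \<delta> * \<phi> / (real k - 1)) \<le> 1 - 1 / \<delta>"
  obtains s :: real where "s < 1"
    "pdiff j f (of_real \<circ> w(j := w j + \<delta>)) = f (of_real \<circ> w(j := w j + \<delta>)) * of_real s"
    "\<And>r. f ((of_real \<circ> w)(j := of_real r)) = 0 \<Longrightarrow> s \<le> 1 - 1 / \<delta> + 1 / (w j + \<delta> - r)"
proof -
  have upd: "(complex_of_real \<circ> w)(j := of_real (w j)) = (of_real \<circ> w)" by auto
  have nz: "f (of_real \<circ> w) \<noteq> 0" using above[of "w j"] upd by simp
  obtain A :: "real multiset" where
    A: "size A \<le> K j" "set_mset A = {r. f ((of_real \<circ> w)(j := of_real r)) = 0}"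
      and ld: "\<And>t. f ((of_real \<circ> w)(j := t)) \<noteq> 0 \<Longrightarrow> pdiff j f ((of_real \<circ> w)(j := t))
        = f ((of_real \<circ> w)(j := t)) * (\<Sum>r\<in>#A. 1 / (t - of_real r))"
    using real_logderiv[OF nz j] by metis
  have less: "r < w j" if "r \<in># A" for r using that A(2) above[of r] by force
  have real: "(\<Sum>r\<in>#A. 1 / (complex_of_real y - of_real r)) = of_real (\<Sum>r\<in>#A. 1 / (y - r))" for y
    by (induction A) auto
  have "(\<Sum>r\<in>#A. 1 / (w j - r)) \<le> \<phi>"
    using bound ld[of "of_real (w j)"] nz unfolding upd real by simp
  then have key: "(\<Sum>r\<in>#A. 1 / (w j + \<delta> - r)) \<le> 1 - 1 / \<delta> + 1 / (w j + \<delta> - l)" if "l \<in># A" for l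
    using shifted_root_sum_bound[OF less _ k(1) _ \<delta> cond that] A(1) k(2) by linarith
  define s where "s = (\<Sum>r\<in>#A. 1 / (w j + \<delta> - r))"
  show ?thesis
  proof
    show "s < 1"
    proof (cases "A = {#}")
      case False
      then obtain l where l: "l \<in># A" by blast
      then have "1 / (w j + \<delta> - l) < 1 / \<delta>" using less[OF l] \<delta> by (intro divide_strict_left_mono) auto
      then show ?thesis using key[OF l] by (simp add: s_def)
    qed (simp add: s_def)
    show "pdiff j f (of_real \<circ> w(j := w j + \<delta>)) = f (of_real \<circ> w(j := w j + \<delta>)) * of_real s"
      using ld[of "of_real (w j + \<delta>)"] above[of "w j + \<delta>"] \<delta> unfolding fun_upd_comp s_def real by simp
    show "s \<le> 1 - 1 / \<delta> + 1 / (w j + \<delta> - r)" if "f ((of_real \<circ> w)(j := of_real r)) = 0" for r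
      using key[of r] A(2) that by (simp add: s_def)
  qed
qed

lemma barrier_shift_nonzero:
  assumes j: "j \<noteq> 0" and k: "k \<ge> 2" "K j \<le> k" and \<delta>: "\<delta> > 0"
    and above: "\<And>t. t \<ge> w j \<Longrightarrow> f ((of_real \<circ> w)(j := of_real t)) \<noteq> 0"
    and bound: "Re (pdiff j f (of_real \<circ> w) / f (of_real \<circ> w)) \<le> \<phi>"
    and cond: "\<phi> / (1 + \<delta> * \<phi> / (real k - 1)) \<le> 1 - 1 / \<delta>"
  shows "one_minus_partial j f (of_real \<circ> w(j := w j + \<delta>)) \<noteq> 0"
proof -
  obtain s :: real where "s < 1"
    "pdiff j f (of_real \<circ> w(j := w j + \<delta>)) = f (of_real \<circ> w(j := w j + \<delta>)) * of_real s"
    using barrier_shift_roots[OF assms] by metis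
  moreover have "f (of_real \<circ> w(j := w j + \<delta>)) \<noteq> 0"
    unfolding fun_upd_comp by (rule above) (use \<delta> in simp)
  ultimately show ?thesis by (simp add: one_minus_partial_eq)
qed

text \<open>Writing the derivative of f in z_i as f \<Phi>, with \<Phi> a function of z_j, the new
  barrier at y is \<Phi>(y) - \<Phi>'(y) / (1 - s) and the old one is \<Phi>(w j). Both are linear
  in the same nonnegative residues, so they can be compared pole by pole.\<close>

lemma barrier_shift_le:
  assumes ij: "i \<noteq> 0" "j \<noteq> 0" "i \<noteq> j" and k: "k \<ge> 2" "K j \<le> k" and \<delta>: "\<delta> > 0"
    and above: "\<And>s t. \<lbrakk>s \<ge> w i; t \<ge> w j\<rbrakk> \<Longrightarrow> f (of_real \<circ> w(i := s, j := t)) \<noteq> 0"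
    and bound: "Re (pdiff j f (of_real \<circ> w) / f (of_real \<circ> w)) \<le> \<phi>"
    and cond: "\<phi> / (1 + \<delta> * \<phi> / (real k - 1)) \<le> 1 - 1 / \<delta>"
  shows "Re (pdiff i (one_minus_partial j f) (of_real \<circ> w(j := w j + \<delta>)) /
      one_minus_partial j f (of_real \<circ> w(j := w j + \<delta>)))
    \<le> Re (pdiff i f (of_real \<circ> w) / f (of_real \<circ> w))"
proof -
  let ?z = "\<lambda>t. (complex_of_real \<circ> w)(j := t)"
  define S where "S = {r. f (?z (of_real r)) = 0}"
  define y where "y = w j + \<delta>"
  have nz: "f (?z (of_real t)) \<noteq> 0" if "t \<ge> w j" for t
    using above[of "w i" t] that ij by (simp add: fun_upd_comp)
  have nzy: "f (?z (of_real y)) \<noteq> 0" 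
    unfolding y_def by (rule nz) (use \<delta> in simp)
  have less: "r < w j" if "r \<in> S" for r using nz that by (force simp: S_def not_le[symmetric])
  obtain s where s: "s < 1" "pdiff j f (?z (of_real y)) = f (?z (of_real y)) * of_real s"
    and s_le: "\<And>r. r \<in> S \<Longrightarrow> s \<le> 1 - 1 / \<delta> + 1 / (y - r)"
    using barrier_shift_roots[OF ij(2) k \<delta> nz bound cond] unfolding S_def y_def fun_upd_comp
    by auto
  obtain a c where a: "\<And>r. a r \<ge> (0::real)"
    and pf: "\<And>t. f (?z t) \<noteq> 0 \<Longrightarrow>
      pdiff i f (?z t) / f (?z t) = c + (\<Sum>r\<in>S. of_real (a r) / (t - of_real r))"
    using logderiv_partial_fractions[OF ij above] unfolding S_def by blast
  obtain D where D: "\<And>t. f (?z t) = poly D t" "\<And>t. pdiff j f (?z t) = poly (pderiv D) t"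
    using poly_inE[OF stable_polyD(1)[OF f, of j]] by metis
  obtain N where N: "\<And>t. pdiff i f (?z t) = poly N t" "\<And>t. pdiff j (pdiff i f) (?z t) = poly (pderiv N) t"
    using poly_inE[OF poly_in_pdiff[OF stable_polyD(1)[OF f, of j] stable_polyD(1)[OF f, of i]]] by metis
  define \<Phi> where "\<Phi> t = c + (\<Sum>r\<in>S. of_real (a r) / (t - of_real r))" for t
  \<comment> \<open>Minus the derivative of \<Phi> at y.\<close>
  define \<Psi> where "\<Psi> = (\<Sum>r\<in>S. a r / (y - r)\<^sup>2)"
  have NY: "poly N t = poly D t * \<Phi> t" if "poly D t \<noteq> 0" for t
    using pf[of t] that by (simp add: D(1) N(1) \<Phi>_def field_simps)
  have Dy: "poly D (of_real y) \<noteq> 0" using nzy D by simp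
  have D'y: "poly (pderiv D) (of_real y) = poly D (of_real y) * of_real s" using s(2) D by simp
  have N'y: "poly (pderiv N) (of_real y) = poly D (of_real y) * (of_real s * \<Phi> (of_real y) - of_real \<Psi>)"
  proof -
    have "(\<Phi> has_field_derivative - of_real \<Psi>) (at (of_real y))"
    proof -
      have "((\<lambda>t. of_real (a r) / (t - of_real r)) has_field_derivative - (of_real (a r / (y - r)\<^sup>2)))
          (at (complex_of_real y))" if "r \<in> S" for r
      proof -
        have "complex_of_real y - of_real r \<noteq> 0"
          using less[OF that] \<delta> by (simp add: y_def complex_eq_iff)
        then show ?thesis by (auto intro!: derivative_eq_intros simp: power2_eq_square)
      qed
      then have "((\<lambda>t. \<Sum>r\<in>S. of_real (a r) / (t - of_real r)) has_field_derivative
          (\<Sum>r\<in>S. - (of_real (a r / (y - r)\<^sup>2)))) (at (complex_of_real y))"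
        by (intro DERIV_sum)
      then have "(\<Phi> has_field_derivative 0 + (\<Sum>r\<in>S. - (of_real (a r / (y - r)\<^sup>2)))) (at (of_real y))"
        unfolding \<Phi>_def[abs_def] by (intro DERIV_add DERIV_const)
      then show ?thesis by (simp add: \<Psi>_def sum_negf)
    qed
    then have "((\<lambda>t. poly D t * \<Phi> t) has_field_derivative
        poly (pderiv D) (of_real y) * \<Phi> (of_real y) + - of_real \<Psi> * poly D (of_real y)) (at (of_real y))"
      by (intro DERIV_mult poly_DERIV)
    \<comment> \<open>The factorization N = D \<Phi> is available only off the roots of D; openness
      of that set suffices for computing the derivative of N at y.\<close>
    moreover have "open {t. poly D t \<noteq> 0}" by (intro open_Collect_neq continuous_intros)
    ultimately have "(poly N has_field_derivative
        poly (pderiv D) (of_real y) * \<Phi> (of_real y) + - of_real \<Psi> * poly D (of_real y)) (at (of_real y))"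
      by (rule has_field_derivative_transform_within_open) (use Dy NY in auto)
    from DERIV_unique[OF poly_DERIV this] show ?thesis
      unfolding D'y by (simp add: algebra_simps)
  qed
  have new: "pdiff i (one_minus_partial j f) (?z (of_real y)) / one_minus_partial j f (?z (of_real y))
      = \<Phi> (of_real y) + of_real (\<Psi> / (1 - s))"
  proof -
    have "pdiff i (one_minus_partial j f) (?z (of_real y)) = poly N (of_real y) - poly (pderiv N) (of_real y)"
    proof -
      have P: "poly_in i (K i) f" "poly_in j (K j) f" using stable_polyD(1)[OF f] by auto
      have "pdiff i (\<lambda>z. f z - pdiff j f z) z = pdiff i f z - pdiff i (pdiff j f) z" for z
        unfolding pdiff_def[of i "\<lambda>z. f z - pdiff j f z"]
        by (intro DERIV_imp_deriv DERIV_diff poly_in_DERIV[OF P(1)]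
          poly_in_DERIV[OF poly_in_pdiff[OF P(1) P(2)]])
      then show ?thesis
        using pdiff_commute[OF P(2,1) ij(3)] N by (simp add: one_minus_partial_eq[abs_def])
    qed
    moreover have "one_minus_partial j f (?z (of_real y)) = poly D (of_real y) - poly (pderiv D) (of_real y)"
      using D by (simp add: one_minus_partial_eq)
    moreover have "1 - complex_of_real s \<noteq> 0" using s(1) by (simp add: complex_eq_iff)
    moreover have "poly N (of_real y) - poly (pderiv N) (of_real y)
        = poly D (of_real y) * ((1 - of_real s) * \<Phi> (of_real y) + of_real \<Psi>)"
      "poly D (of_real y) - poly (pderiv D) (of_real y) = poly D (of_real y) * (1 - of_real s)"
      unfolding NY[OF Dy] N'y D'y by (simp_all add: algebra_simps)
    ultimately show ?thesis using Dy by (simp add: add_divide_distrib)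
  qed
  have real: "Re (\<Phi> (of_real t)) = Re c + (\<Sum>r\<in>S. a r / (t - r))" for t
    by (simp add: \<Phi>_def flip: of_real_diff of_real_divide)
  have old: "Re (pdiff i f (of_real \<circ> w) / f (of_real \<circ> w)) = Re c + (\<Sum>r\<in>S. a r / (w j - r))"
  proof -
    have "?z (of_real (w j)) = of_real \<circ> w" by auto
    then show ?thesis using pf[OF nz[of "w j"]] real[of "w j"] by (simp add: \<Phi>_def)
  qed
  have "(\<Sum>r\<in>S. a r / (y - r)) + \<Psi> / (1 - s) = (\<Sum>r\<in>S. a r / (y - r) + a r / (y - r)\<^sup>2 / (1 - s))"
    by (simp add: \<Psi>_def sum.distrib sum_divide_distrib)
  also have "\<dots> \<le> (\<Sum>r\<in>S. a r / (w j - r))"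
  proof (rule sum_mono)
    fix r assume r: "r \<in> S"
    define x where "x = w j - r"
    have x: "x > 0" "y - r = x + \<delta>" using less[OF r] by (auto simp: x_def y_def)
    \<comment> \<open>This lower bound on 1 - s is equivalent to 1 / (x + \<delta>) + 1 / ((x +
      \<delta>)^2 (1 - s)) <= 1 / x, the comparison for the pole r.\<close>
    have "1 / \<delta> - 1 / (x + \<delta>) \<le> 1 - s" using s_le[OF r] x by simp
    moreover have "1 / \<delta> - 1 / (x + \<delta>) = x / (\<delta> * (x + \<delta>))" using x \<delta> by (simp add: divide_simps)
    ultimately have "1 / (1 - s) \<le> \<delta> * (x + \<delta>) / x"
      using x \<delta> s(1) by (simp add: divide_simps mult.commute)
    then have "1 / (x + \<delta>)\<^sup>2 * (1 / (1 - s)) \<le> 1 / (x + \<delta>)\<^sup>2 * (\<delta> * (x + \<delta>) / x)"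
      by (intro mult_left_mono) auto
    also have "\<dots> = 1 / x - 1 / (x + \<delta>)"
      using x \<delta> by (simp add: divide_simps power2_eq_square)
    finally have "a r * (1 / (x + \<delta>) + 1 / (x + \<delta>)\<^sup>2 / (1 - s)) \<le> a r * (1 / x)"
      using a by (intro mult_left_mono) auto
    then show "a r / (y - r) + a r / (y - r)\<^sup>2 / (1 - s) \<le> a r / (w j - r)"
      unfolding x(2) x_def[symmetric] by (simp add: distrib_left)
  qed
  finally show ?thesis
    using new real[of y] old unfolding y_def fun_upd_comp by simp
qed

end

section \<open>Determinantal pencils\<close>

text \<open>Multilinearity in the rows: the predicate S marks the rows taken from B. The
  coefficients of the resulting polynomial in t are mixed determinants.\<close>

lemma det_add_scaled:
  fixes A B :: "complex^'n^'n"
  shows "det (A + (\<chi> a b. t * B $ a $ b)) =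
    (\<Sum>S\<in>UNIV. t ^ card {i. S i} * det (\<chi> i. if S i then B $ i else A $ i))"
proof -
  let ?M = "\<lambda>S. \<chi> i. if i \<in> S then B $ i else A $ i"
  have prod: "(\<Prod>i\<in>UNIV. t * B $ i $ p i + A $ i $ p i)
      = (\<Sum>S\<in>UNIV. t ^ card S * (\<Prod>i\<in>UNIV. ?M S $ i $ p i))" for p :: "'n \<Rightarrow> 'n"
  proof -
    have "(\<Prod>i\<in>UNIV. t * B $ i $ p i + A $ i $ p i)
        = (\<Sum>S\<in>UNIV. (\<Prod>i\<in>S. t * B $ i $ p i) * (\<Prod>i\<in>UNIV - S. A $ i $ p i))"
      by (simp add: prod_add)
    also have "\<dots> = (\<Sum>S\<in>UNIV. t ^ card S * (\<Prod>i\<in>UNIV. ?M S $ i $ p i))"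
    proof (rule sum.cong)
      fix S :: "'n set"
      have "(\<Prod>i\<in>UNIV. ?M S $ i $ p i) = (\<Prod>i\<in>UNIV. if i \<in> S then B $ i $ p i else A $ i $ p i)"
        by (intro prod.cong) auto
      also have "\<dots> = (\<Prod>i\<in>S. B $ i $ p i) * (\<Prod>i\<in>UNIV - S. A $ i $ p i)"
        by (simp add: prod.If_cases Compl_eq_Diff_UNIV)
      finally show "(\<Prod>i\<in>S. t * B $ i $ p i) * (\<Prod>i\<in>UNIV - S. A $ i $ p i)
          = t ^ card S * (\<Prod>i\<in>UNIV. ?M S $ i $ p i)"
        by (simp add: prod.distrib)
    qed simp
    finally show ?thesis .
  qed
  have "det (A + (\<chi> a b. t * B $ a $ b)) = (\<Sum>p | p permutes UNIV. \<Sum>S\<in>UNIV.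
      t ^ card S * (of_int (sign p) * (\<Prod>i\<in>UNIV. ?M S $ i $ p i)))"
    unfolding det_def using prod by (simp add: sum_distrib_left mult_ac add.commute)
  also have "\<dots> = (\<Sum>S\<in>UNIV. t ^ card S * det (?M S))"
    unfolding det_def by (subst sum.swap) (simp add: sum_distrib_left)
  also have "\<dots> = (\<Sum>S\<in>UNIV. t ^ card {i. S i} * det (\<chi> i. if S i then B $ i else A $ i))"
    by (rule sum.reindex_bij_witness[of _ Collect "\<lambda>S i. i \<in> S"]) auto
  finally show ?thesis .
qed

text \<open>More than \<open>rank B\<close> rows of B are dependent. Since \<open>rows\<close> is a
  set, repeated rows are a separate case. This is how the rank hypothesis becomes a degree bound in
  z_i.\<close>

lemma det_mixed_rows_eq_0:
  fixes A B :: "complex^'n^'n"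
  assumes "rank B < card {i. S i}"
  shows "det (\<chi> i. if S i then B $ i else A $ i) = 0"
proof -
  let ?M = "\<chi> i. if S i then B $ i else A $ i"
  show ?thesis
  proof (cases "inj_on (\<lambda>i. B $ i) {i. S i}")
    case True
    let ?R = "(\<lambda>i. B $ i) ` {i. S i}"
    have card: "card ?R = card {i. S i}" using True by (rule card_image)
    have "?R \<subseteq> rows B" by (auto simp: rows_def row_def vec_lambda_eta)
    have "vec.dependent ?R"
    proof (rule ccontr)
      assume "\<not> vec.dependent ?R"
      then have "card ?R \<le> vec.dim (rows B)"
        using \<open>?R \<subseteq> rows B\<close> vec.independent_card_le_dim by blast
      then show False using assms card by (simp add: row_rank_def_gen)
    qed
    moreover have "?R \<subseteq> rows ?M" by (force simp: rows_def row_def vec_lambda_eta)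
    ultimately have "vec.dependent (rows ?M)" by (rule vec.dependent_mono)
    then show ?thesis by (rule det_dependent_rows)
  next
    case False
    then obtain i j where "S i" "S j" "i \<noteq> j" "B $ i = B $ j" by (auto simp: inj_on_def)
    then show ?thesis by (intro det_identical_rows[of i j]) (auto simp: row_def vec_lambda_eta)
  qed
qed

lemma det_add_scaled_poly:
  fixes A B :: "complex^'n^'n"
  assumes "\<And>S. n < card {i. S i} \<Longrightarrow> det (\<chi> i. if S i then B $ i else A $ i) = 0"
  shows "\<exists>p. degree p \<le> n \<and> (\<forall>t. det (A + (\<chi> a b. t * B $ a $ b)) = poly p t)"
proof (intro exI conjI allI)
  let ?p = "\<Sum>S\<in>UNIV. monom (det (\<chi> i. if S i then B $ i else A $ i)) (card {i. S i})"
  show "degree ?p \<le> n"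
  proof (rule degree_sum_le)
    fix S :: "'n \<Rightarrow> bool"
    show "degree (monom (det (\<chi> i. if S i then B $ i else A $ i)) (card {i. S i})) \<le> n"
      using assms[of S] by (cases "n < card {i. S i}") (auto intro: order.trans[OF degree_monom_le])
  qed simp
  show "det (A + (\<chi> a b. t * B $ a $ b)) = poly ?p t" for t
    by (simp add: det_add_scaled poly_sum poly_monom mult.commute)
qed

section \<open>Hermitian forms and positive semidefinite matrices\<close>

definition qform :: "complex^'n^'n \<Rightarrow> complex^'n \<Rightarrow> complex" where
  "qform A v = (\<Sum>i\<in>UNIV. cnj (v $ i) * (A *v v) $ i)"

lemma qform_eq: "qform A v = (\<Sum>i\<in>UNIV. \<Sum>j\<in>UNIV. cnj (v $ i) * A $ i $ j * v $ j)"
  by (simp add: qform_def matrix_vector_mult_def sum_distrib_left mult.assoc)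

lemma qform_linear:
  "qform (A + B) v = qform A v + qform B v"
  "qform (A - B) v = qform A v - qform B v"
  "qform (\<chi> a b. c * A $ a $ b) v = c * qform A v"
  by (simp_all add: qform_eq algebra_simps sum.distrib sum_subtractf sum_distrib_left)

lemma qform_sum: "qform (\<Sum>i\<in>I. A i) v = (\<Sum>i\<in>I. qform (A i) v)"
proof (induction I rule: infinite_finite_induct)
  case (insert x F)
  then show ?case by (simp add: qform_linear)
qed (auto simp: qform_eq)

lemma qform_mat: "qform (mat x) v = x * of_real (\<Sum>i\<in>UNIV. (norm (v $ i))\<^sup>2)"
proof -
  have "qform (mat x) v = (\<Sum>i\<in>UNIV. cnj (v $ i) * x * v $ i)"
    unfolding qform_eq by (intro sum.cong) (auto simp: mat_def if_distrib if_distribR sum.delta' cong: if_cong)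
  also have "\<dots> = (\<Sum>i\<in>UNIV. x * of_real ((norm (v $ i))\<^sup>2))"
    by (intro sum.cong) (auto simp: complex_norm_square[symmetric] mult_ac)
  finally show ?thesis by (simp add: sum_distrib_left)
qed

lemma sum_norm_squares_pos:
  fixes v :: "complex^'n"
  assumes "v \<noteq> 0"
  shows "(\<Sum>i\<in>UNIV. (norm (v $ i))\<^sup>2) > 0"
proof -
  obtain i where "v $ i \<noteq> 0" using assms by (auto simp: vec_eq_iff)
  then show ?thesis by (intro sum_pos2[of _ i]) auto
qed

lemma psd_matrix_cnj:
  assumes "psd_matrix A"
  shows "cnj (A $ i $ j) = A $ j $ i"
  using assms by (metis hermitian_matrix_def psd_matrix_def)

lemma psd_matrix_qform:
  assumes "psd_matrix A"
  shows "Re (qform A v) \<ge> 0" "Im (qform A v) = 0"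
proof -
  show "Re (qform A v) \<ge> 0" using assms by (simp add: psd_matrix_def qform_def)
  have "cnj (qform A v) = (\<Sum>i\<in>UNIV. \<Sum>j\<in>UNIV. v $ i * A $ j $ i * cnj (v $ j))"
    by (simp add: qform_eq psd_matrix_cnj[OF assms])
  also have "\<dots> = (\<Sum>j\<in>UNIV. \<Sum>i\<in>UNIV. v $ i * A $ j $ i * cnj (v $ j))" by (rule sum.swap)
  also have "\<dots> = qform A v" unfolding qform_eq by (intro sum.cong) auto
  finally show "Im (qform A v) = 0" by (simp add: complex_eq_iff)
qed

lemma psd_matrixI:
  assumes "hermitian_matrix A" "\<And>v. Re (qform A v) \<ge> 0"
  shows "psd_matrix A"
  using assms by (simp add: psd_matrix_def qform_def)

text \<open>A nonzero kernel vector would be a zero of the form.\<close>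

lemma det_nonzero_if_qform_nonzero:
  fixes A :: "complex^'n^'n"
  assumes "\<And>v. v \<noteq> 0 \<Longrightarrow> qform A v \<noteq> 0"
  shows "det A \<noteq> 0"
proof -
  have "v = 0" if "A *v v = 0" for v using assms[of v] that by (auto simp: qform_def)
  then have "invertible A" by (simp add: invertible_left_inverse matrix_left_invertible_ker)
  then show ?thesis by (simp add: invertible_det_nz)
qed

lemma psd_matrix_add:
  assumes "psd_matrix A" "psd_matrix B"
  shows "psd_matrix (A + B)"
  using psd_matrix_qform(1)[OF assms(1)] psd_matrix_qform(1)[OF assms(2)]
  by (intro psd_matrixI)
    (simp_all add: hermitian_matrix_def psd_matrix_cnj[OF assms(1)] psd_matrix_cnj[OF assms(2)] qform_linear)

lemma psd_matrix_scale:
  assumes "psd_matrix A" "c \<ge> 0"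
  shows "psd_matrix (\<chi> a b. of_real c * A $ a $ b)"
proof (rule psd_matrixI)
  show "hermitian_matrix (\<chi> a b. of_real c * A $ a $ b)"
    by (simp add: hermitian_matrix_def psd_matrix_cnj[OF assms(1)])
  show "Re (qform (\<chi> a b. of_real c * A $ a $ b) v) \<ge> 0" for v
    using psd_matrix_qform(1)[OF assms(1)] assms(2) by (simp add: qform_linear)
qed

lemma psd_matrix_sum:
  assumes "\<And>i. i \<in> I \<Longrightarrow> psd_matrix (A i)"
  shows "psd_matrix (\<Sum>i\<in>I. A i)"
proof -
  have "psd_matrix 0" by (intro psd_matrixI) (auto simp: hermitian_matrix_def qform_eq)
  then show ?thesis using assms
    by (induction I rule: infinite_finite_induct) (auto intro: psd_matrix_add)
qed

lemma det_cnj: "det (\<chi> a b. cnj (A $ a $ b)) = cnj (det (A :: complex^'n^'n))"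
  by (simp add: det_def)

text \<open>The variable x of the mixed characteristic polynomial is stored as coordinate 0 of
  z.\<close>

definition pencil :: "nat \<Rightarrow> (nat \<Rightarrow> complex^'n^'n) \<Rightarrow> (nat \<Rightarrow> complex) \<Rightarrow> complex^'n^'n" where
  "pencil m X z = mat (z 0) + (\<Sum>i=1..m. \<chi> a b. z i * X i $ a $ b)"

lemma qform_pencil:
  "qform (pencil m X z) v = z 0 * of_real (\<Sum>i\<in>UNIV. (norm (v $ i))\<^sup>2) + (\<Sum>i=1..m. z i * qform (X i) v)"
  by (simp add: pencil_def qform_linear qform_sum qform_mat)

lemma pencil_nth: "pencil m X z $ a $ b = (if a = b then z 0 else 0) + (\<Sum>i=1..m. z i * X i $ a $ b)"
  by (simp add: pencil_def mat_def)

lemma pencil_upd: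
  assumes "j \<in> {1..m}"
  shows "pencil m X (z(j := t)) = pencil m X z + (\<chi> a b. (t - z j) * X j $ a $ b)"
proof -
  have "(\<Sum>i=1..m. (z(j := t)) i * X i $ a $ b) = (\<Sum>i=1..m. z i * X i $ a $ b) + (t - z j) * X j $ a $ b" for a b
  proof -
    have "(\<Sum>i=1..m. (z(j := t)) i * X i $ a $ b)
        = (\<Sum>i=1..m. z i * X i $ a $ b + (if i = j then (t - z j) * X j $ a $ b else 0))"
      by (intro sum.cong) (auto simp: algebra_simps)
    also have "\<dots> = (\<Sum>i=1..m. z i * X i $ a $ b) + (t - z j) * X j $ a $ b"
      using assms by (simp add: sum.distrib)
    finally show ?thesis .
  qed
  then show ?thesis using assms by (simp add: vec_eq_iff pencil_nth del: fun_upd_apply) simp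
qed

lemma pencil_upd_0:
  "pencil m X (z(0 := t)) = pencil m X (z(0 := 0)) + (\<chi> a b. t * mat 1 $ a $ b)"
  by (simp add: vec_eq_iff pencil_nth mat_def)

text \<open>Degree bounds for the determinant in each z_j: z_0 multiplies the identity, and beyond m
  the determinant is constant in z_j.\<close>

definition rank_bound :: "nat \<Rightarrow> (nat \<Rightarrow> complex^'n^'n) \<Rightarrow> nat \<Rightarrow> nat" where
  "rank_bound m X j = (if j \<in> {1..m} then rank (X j) else CARD('n))"

lemma poly_in_det_pencil: "poly_in j (rank_bound m X j) (\<lambda>z. det (pencil m X z))"
  for X :: "nat \<Rightarrow> complex^'n^'n"
  unfolding poly_in_def
proof
  fix z
  consider "j = 0" | "j \<in> {1..m}" | "j > m" "j \<noteq> 0" by fastforce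
  then show "\<exists>p. degree p \<le> rank_bound m X j \<and> (\<forall>t. det (pencil m X (z(j := t))) = poly p t)"
  proof cases
    case 1
    have "\<not> CARD('n) < card {i::'n. S i}" for S by (simp add: card_mono not_less)
    then have "\<exists>p. degree p \<le> CARD('n) \<and>
        (\<forall>t. det (pencil m X (z(0 := 0)) + (\<chi> a b. t * mat 1 $ a $ b)) = poly p t)"
      by (intro det_add_scaled_poly) auto
    then show ?thesis using 1 by (simp add: rank_bound_def flip: pencil_upd_0)
  next
    case 2
    have "\<exists>p. degree p \<le> rank (X j) \<and>
        (\<forall>t. det (pencil m X (z(j := 0)) + (\<chi> a b. t * X j $ a $ b)) = poly p t)"
      by (intro det_add_scaled_poly det_mixed_rows_eq_0)
    moreover have "pencil m X (z(j := 0)) + (\<chi> a b. t * X j $ a $ b) = pencil m X (z(j := t))" for t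
      using pencil_upd[OF 2, of X "z(j := 0)" t] by simp
    ultimately show ?thesis using 2 by (simp add: rank_bound_def)
  next
    case 3
    then have "pencil m X (z(j := t)) = pencil m X z" for t
      by (auto simp: vec_eq_iff pencil_nth intro!: sum.cong)
    then show ?thesis by (intro exI[of _ "[:det (pencil m X z):]"]) simp
  qed
qed

text \<open>The term that takes every row from the identity is split off as z_0^d. Monicity later
  ensures that roots exist and are finite in number.\<close>

lemma det_pencil_monic:
  "poly_in 0 (CARD('n) - 1) (\<lambda>z. det (pencil m X z) - z 0 ^ CARD('n))"
  for X :: "nat \<Rightarrow> complex^'n^'n"
  unfolding poly_in_def
proof
  fix z
  let ?c = "\<lambda>S. det (\<chi> i. if S i then (mat 1 :: complex^'n^'n) $ i else pencil m X (z(0 := 0)) $ i)"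
  let ?U = "UNIV - {\<lambda>_::'n. True}"
  let ?p = "\<Sum>S\<in>?U. monom (?c S) (card {i. S i})"
  have "card {i. S i} \<le> CARD('n) - 1" if "S \<in> ?U" for S
  proof -
    have "card {i. S i} < CARD('n)" using that by (intro psubset_card_mono) auto
    then show ?thesis by linarith
  qed
  then have "degree ?p \<le> CARD('n) - 1"
    by (intro degree_sum_le order.trans[OF degree_monom_le]) auto
  moreover have "det (pencil m X (z(0 := t))) - t ^ CARD('n) = poly ?p t" for t
  proof -
    have "det (pencil m X (z(0 := t))) = (\<Sum>S\<in>UNIV. t ^ card {i. S i} * ?c S)"
      unfolding pencil_upd_0[of m X z t] det_add_scaled ..
    also have "\<dots> = t ^ CARD('n) * ?c (\<lambda>_. True) + (\<Sum>S\<in>?U. t ^ card {i. S i} * ?c S)"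
      by (subst sum.remove[of _ "\<lambda>_. True"]) auto
    finally show ?thesis by (simp add: poly_sum poly_monom mult.commute vec_lambda_eta)
  qed
  ultimately show "\<exists>p. degree p \<le> CARD('n) - 1 \<and>
      (\<forall>t. det (pencil m X (z(0 := t))) - (z(0 := t)) 0 ^ CARD('n) = poly p t)"
    by (intro exI[of _ ?p]) simp
qed

text \<open>The imaginary part of the form of the pencil at v is Im z_0 |v|^2 plus nonnegative terms
  Im z_i times the form of X_i, so the kernel is trivial. Conjugating z transposes and conjugates
  the pencil, as the X_i are Hermitian.\<close>

lemma stable_poly_det_pencil:
  fixes X :: "nat \<Rightarrow> complex^'n^'n"
  assumes psd: "\<And>i. i \<in> {1..m} \<Longrightarrow> psd_matrix (X i)"
  shows "stable_poly (rank_bound m X) (\<lambda>z. det (pencil m X z))"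
  unfolding stable_poly_def
proof (intro conjI allI impI)
  fix j show "poly_in j (rank_bound m X j) (\<lambda>z. det (pencil m X z))" by (rule poly_in_det_pencil)
next
  fix z
  have "pencil m X (cnj \<circ> z) = transpose (\<chi> a b. cnj (pencil m X z $ a $ b))"
    using psd by (simp add: vec_eq_iff pencil_nth transpose_def psd_matrix_cnj)
  then show "det (pencil m X (cnj \<circ> z)) = cnj (det (pencil m X z))"
    by (simp add: det_cnj)
next
  fix z :: "nat \<Rightarrow> complex"
  assume z: "Im (z 0) > 0" "\<forall>i. Im (z i) \<ge> 0"
  show "det (pencil m X z) \<noteq> 0"
  proof (rule det_nonzero_if_qform_nonzero)
    fix v :: "complex^'n" assume v: "v \<noteq> 0"
    have "(\<Sum>i=1..m. Im (z i * qform (X i) v)) \<ge> 0"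
      using psd_matrix_qform[OF psd] z(2) by (intro sum_nonneg) simp
    moreover have "Im (z 0) * (\<Sum>i\<in>UNIV. (norm (v $ i))\<^sup>2) > 0"
      using z(1) sum_norm_squares_pos[OF v] by simp
    ultimately have "Im (qform (pencil m X z) v) > 0" by (simp add: qform_pencil)
    then show "qform (pencil m X z) v \<noteq> 0" by auto
  qed
qed

lemma det_pencil_nonzero:
  fixes X :: "nat \<Rightarrow> complex^'n^'n"
  assumes psd: "\<And>i. i \<in> {1..m} \<Longrightarrow> psd_matrix (X i)"
    and w: "w 0 > 0" "\<And>i. i \<in> {1..m} \<Longrightarrow> w i \<ge> 0"
  shows "det (pencil m X (of_real \<circ> w)) \<noteq> 0"
proof (rule det_nonzero_if_qform_nonzero)
  fix v :: "complex^'n" assume v: "v \<noteq> 0"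
  have "(\<Sum>i=1..m. Re (of_real (w i) * qform (X i) v)) \<ge> 0"
    using psd_matrix_qform[OF psd] w(2) by (intro sum_nonneg) simp
  moreover have "w 0 * (\<Sum>i\<in>UNIV. (norm (v $ i))\<^sup>2) > 0"
    using w(1) sum_norm_squares_pos[OF v] by simp
  ultimately have "Re (qform (pencil m X (of_real \<circ> w)) v) > 0" by (simp add: qform_pencil)
  then show "qform (pencil m X (of_real \<circ> w)) v \<noteq> 0" by auto
qed

text \<open>Jacobi's formula at a scalar matrix, read off from the row expansion.\<close>

lemma deriv_det_scalar:
  fixes X :: "complex^'n^'n"
  assumes "t \<noteq> 0"
  shows "deriv (\<lambda>s. det (mat t + (\<chi> a b. s * X $ a $ b))) 0 = trace X / t * det (mat t :: complex^'n^'n)"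
proof -
  let ?c = "\<lambda>S. det (\<chi> i. if S i then X $ i else (mat t :: complex^'n^'n) $ i)"
  have "((\<lambda>s. det (mat t + (\<chi> a b. s * X $ a $ b))) has_field_derivative
      (\<Sum>S\<in>UNIV. of_nat (card {i. S i}) * 0 ^ (card {i. S i} - 1) * ?c S)) (at 0)"
    unfolding det_add_scaled by (auto intro!: derivative_eq_intros sum.cong)
  then have "deriv (\<lambda>s. det (mat t + (\<chi> a b. s * X $ a $ b))) 0
      = (\<Sum>S\<in>UNIV. of_nat (card {i. S i}) * 0 ^ (card {i. S i} - 1) * ?c S)"
    by (rule DERIV_imp_deriv)
  \<comment> \<open>The factor card * 0^(card - 1) is 1 for singletons, by 0^0 = 1, and 0 otherwise;
    the empty choice is killed by card = 0.\<close>
  also have "\<dots> = (\<Sum>S\<in>(\<lambda>k i. i = k) ` UNIV. of_nat (card {i. S i}) * 0 ^ (card {i. S i} - 1) * ?c S)"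
  proof (rule sum.mono_neutral_right)
    show "\<forall>S\<in>UNIV - (\<lambda>k i. i = k) ` UNIV. of_nat (card {i. S i}) * 0 ^ (card {i. S i} - 1) * ?c S = 0"
    proof
      fix S :: "'n \<Rightarrow> bool" assume S: "S \<in> UNIV - (\<lambda>k i. i = k) ` UNIV"
      have "card {i. S i} \<noteq> 1"
      proof
        assume "card {i. S i} = 1"
        then obtain k where "{i. S i} = {k}" by (auto simp: card_1_singleton_iff)
        then have "S = (\<lambda>i. i = k)" by auto
        then show False using S by auto
      qed
      then show "of_nat (card {i. S i}) * 0 ^ (card {i. S i} - 1) * ?c S = 0"
        by (cases "card {i. S i}") auto
    qed
  qed auto
  also have "\<dots> = (\<Sum>k\<in>UNIV. ?c (\<lambda>i. i = k))"
    by (subst sum.reindex) (auto simp: inj_on_def fun_eq_iff)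
  also have "\<dots> = (\<Sum>k\<in>UNIV. X $ k $ k / t * det (mat t :: complex^'n^'n))"
  proof (rule sum.cong)
    fix k :: 'n
    \<comment> \<open>Row k of X is the combination of the rows of t I with coefficients X_ki / t,
      and Cramer's rule extracts the k-th coefficient.\<close>
    have "(\<Sum>i\<in>UNIV. (\<chi> i. X $ k $ i / t) $ i *s row i (mat t)) $ b
        = (\<Sum>i\<in>UNIV. if i = b then X $ k $ b else 0)" for b
      unfolding sum_component by (intro sum.cong) (use assms in \<open>auto simp: row_def mat_def\<close>)
    then have eq: "(\<Sum>i\<in>UNIV. (\<chi> i. X $ k $ i / t) $ i *s row i (mat t)) = X $ k"
      unfolding vec_eq_iff by simp
    have "(\<chi> i. if i = k then X $ i else (mat t :: complex^'n^'n) $ i)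
        = (\<chi> i. if i = k then (\<Sum>i\<in>UNIV. (\<chi> i. X $ k $ i / t) $ i *s row i (mat t)) else row i (mat t))"
      unfolding eq by (simp add: vec_eq_iff row_def)
    then have "?c (\<lambda>i. i = k) = (\<chi> i. X $ k $ i / t) $ k * det (mat t :: complex^'n^'n)"
      by (simp only: cramer_lemma_transpose)
    then show "?c (\<lambda>i. i = k) = X $ k $ k / t * det (mat t :: complex^'n^'n)" by simp
  qed simp
  finally show ?thesis by (simp add: trace_def sum_divide_distrib sum_distrib_right)
qed

text \<open>Moving from \<open>t I\<close> to \<open>t I + P\<close> along \<open>P\<close> only decreases the barrier.\<close>

lemma psd_logderiv_le:
  fixes P X :: "complex^'n^'n"
  assumes P: "psd_matrix P" and X: "psd_matrix X" and t: "t > 0"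
  shows "Re (deriv (\<lambda>s. det (mat (of_real t) + P + (\<chi> a b. (s - c) * X $ a $ b))) c /
    det (mat (of_real t) + P)) \<le> Re (trace X) / t"
proof -
  \<comment> \<open>The path is the first variable of the pencil t I + z_1 P + z_2 X, moved from 0
    to 1; the barrier in question is the one in z_2.\<close>
  define Y where "Y = (\<lambda>i::nat. if i = 1 then P else X)"
  define F where "F = (\<lambda>z. det (pencil 2 Y z))"
  define w where "w = (\<lambda>i::nat. if i = 0 then t else 0)"
  have Y: "psd_matrix (Y i)" for i using P X by (simp add: Y_def)
  have F: "stable_poly (rank_bound 2 Y) F" unfolding F_def using Y by (rule stable_poly_det_pencil)
  have set2: "{Suc 0..2} = {1, 2}" by auto
  have pencil: "pencil 2 Y ((of_real \<circ> w)(1 := u, 2 := s))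
      = mat (of_real t) + (\<chi> a b. u * P $ a $ b) + (\<chi> a b. s * X $ a $ b)" for u s
    by (simp add: vec_eq_iff pencil_nth set2 Y_def w_def mat_def)
  have "Re (pdiff 2 F (of_real \<circ> w(1 := w 1 + 1)) / F (of_real \<circ> w(1 := w 1 + 1)))
      \<le> Re (pdiff 2 F (of_real \<circ> w) / F (of_real \<circ> w))"
  proof (rule logderiv_antimono[OF F])
    show "F (of_real \<circ> w(2 := s, 1 := u)) \<noteq> 0" if "s \<ge> w 2" "u \<ge> w 1" for s u
      unfolding F_def using that t Y by (intro det_pencil_nonzero) (auto simp: w_def)
  qed auto
  moreover have "pdiff 2 F (of_real \<circ> w) = trace X / of_real t * det (mat (of_real t) :: complex^'n^'n)"
    "F (of_real \<circ> w) = det (mat (of_real t) :: complex^'n^'n)"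
  proof -
    have "(of_real \<circ> w)(1 := 0, 2 := s) = (complex_of_real \<circ> w)(2 := s)" for s by (auto simp: w_def)
    then have *: "F ((of_real \<circ> w)(2 := s)) = det (mat (of_real t) + (\<chi> a b. s * X $ a $ b))" for s
      using pencil[of 0 s] by (simp add: F_def vec_lambda_eta flip: zero_vec_def) 
    then show "pdiff 2 F (of_real \<circ> w) = trace X / of_real t * det (mat (of_real t) :: complex^'n^'n)"
      using t deriv_det_scalar[of "of_real t" X] by (simp add: pdiff_def w_def)
    have "(complex_of_real \<circ> w)(2 := 0) = of_real \<circ> w" by (auto simp: w_def)
    then show "F (of_real \<circ> w) = det (mat (of_real t) :: complex^'n^'n)"
      using *[of 0] by (simp flip: zero_vec_def)
  qed
  moreover have "F (of_real \<circ> w) \<noteq> 0"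
    unfolding F_def using t Y by (intro det_pencil_nonzero) (auto simp: w_def)
  moreover have "pdiff 2 F (of_real \<circ> w(1 := w 1 + 1))
      = deriv (\<lambda>s. det (mat (of_real t) + P + (\<chi> a b. (s - c) * X $ a $ b))) c"
    "F (of_real \<circ> w(1 := w 1 + 1)) = det (mat (of_real t) + P)"
  proof -
    have "(of_real \<circ> w)(1 := 1, 2 := s) = (complex_of_real \<circ> w(1 := w 1 + 1))(2 := s)" for s
      by (auto simp: w_def)
    then have *: "F ((of_real \<circ> w(1 := w 1 + 1))(2 := s)) = det (mat (of_real t) + P + (\<chi> a b. s * X $ a $ b))" for s
      using pencil[of 1 s] by (simp add: F_def vec_lambda_eta)
    have "(complex_of_real \<circ> w(1 := w 1 + 1))(2 := 0) = of_real \<circ> w(1 := w 1 + 1)" by (auto simp: w_def)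
    then show "F (of_real \<circ> w(1 := w 1 + 1)) = det (mat (of_real t) + P)"
      using *[of 0] by (simp flip: zero_vec_def)
    obtain p where p: "\<And>s. F ((of_real \<circ> w(1 := w 1 + 1))(2 := s)) = poly p s"
      "\<And>s. pdiff 2 F ((of_real \<circ> w(1 := w 1 + 1))(2 := s)) = poly (pderiv p) s"
      using poly_inE[OF stable_polyD(1)[OF F, of 2]] by metis
    have "((\<lambda>s. poly p (s - c)) has_field_derivative poly (pderiv p) (c - c) * 1) (at c)"
      by (rule DERIV_chain2[OF poly_DERIV]) (auto intro!: derivative_eq_intros)
    then have "deriv (\<lambda>s. poly p (s - c)) c = poly (pderiv p) 0"
      by (auto dest: DERIV_imp_deriv)
    moreover have "det (mat (of_real t) + P + (\<chi> a b. (s - c) * X $ a $ b)) = poly p (s - c)" for s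
      by (rule trans[OF *[symmetric] p(1)])
    ultimately show "pdiff 2 F (of_real \<circ> w(1 := w 1 + 1))
      = deriv (\<lambda>s. det (mat (of_real t) + P + (\<chi> a b. (s - c) * X $ a $ b))) c"
      using p(2)[of 0] \<open>(complex_of_real \<circ> w(1 := w 1 + 1))(2 := 0) = of_real \<circ> w(1 := w 1 + 1)\<close>
      by simp
  qed
  ultimately show ?thesis by simp
qed

section \<open>The mixed characteristic polynomial\<close>

text \<open>The bound is demanded at all points above w in the directions J, not only at w, so that
  a step can be applied at each such point. Coordinates outside J, namely x and those already
  treated, are frozen.\<close>

definition barrier :: "nat set \<Rightarrow> real \<Rightarrow> ((nat \<Rightarrow> complex) \<Rightarrow> complex) \<Rightarrow> (nat \<Rightarrow> real) \<Rightarrow> bool" where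
  "barrier J \<phi> f w \<longleftrightarrow> (\<forall>w'. (\<forall>l. w l \<le> w' l) \<longrightarrow> (\<forall>l. l \<notin> J \<longrightarrow> w' l = w l) \<longrightarrow>
     f (of_real \<circ> w') \<noteq> 0 \<and>
     (\<forall>i\<in>J. Re (pdiff i f (of_real \<circ> w') / f (of_real \<circ> w')) \<le> \<phi>))"

lemma barrierD:
  assumes "barrier J \<phi> f w" "\<And>l. w l \<le> w' l" "\<And>l. l \<notin> J \<Longrightarrow> w' l = w l"
  shows "f (of_real \<circ> w') \<noteq> 0"
    "i \<in> J \<Longrightarrow> Re (pdiff i f (of_real \<circ> w') / f (of_real \<circ> w')) \<le> \<phi>"
  using assms unfolding barrier_def by blast+

text \<open>The one-variable shift estimates are applied at every point above w, which makes the new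
  barrier hold on the whole shifted orthant.\<close>

lemma barrier_step:
  assumes f: "stable_poly K f" and b: "barrier J \<phi> f w" and J: "j \<in> J" "0 \<notin> J"
    and k: "k \<ge> 2" "K j \<le> k" and \<delta>: "\<delta> > 0"
    and cond: "\<phi> / (1 + \<delta> * \<phi> / (real k - 1)) \<le> 1 - 1 / \<delta>"
  shows "barrier (J - {j}) \<phi> (one_minus_partial j f) (w(j := w j + \<delta>))"
  unfolding barrier_def
proof (intro allI impI conjI ballI)
  fix w' assume w': "\<forall>l. (w(j := w j + \<delta>)) l \<le> w' l" "\<forall>l. l \<notin> J - {j} \<longrightarrow> w' l = (w(j := w j + \<delta>)) l"
  \<comment> \<open>Undoes the shift in coordinate j, where w' is frozen at w j + \<delta>; the
    result is a point above w.\<close>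
  define u where "u = w'(j := w j)"
  have u: "w l \<le> u l" "l \<notin> J \<Longrightarrow> u l = w l" for l
    using w'(1)[rule_format, of l] w'(2)[rule_format, of l] by (auto simp: u_def split: if_splits)
  have "w' j = w j + \<delta>" using w'(2)[rule_format, of j] by simp
  then have w'_eq: "w' = u(j := u j + \<delta>)" by (auto simp: u_def)
  have above1: "f ((of_real \<circ> u)(j := of_real t)) \<noteq> 0" if "t \<ge> u j" for t
  proof -
    have "f (of_real \<circ> u(j := t)) \<noteq> 0"
    proof (rule barrierD(1)[OF b])
      show "w l \<le> (u(j := t)) l" for l using u(1)[of l] u(1)[of j] that by auto
      show "(u(j := t)) l = w l" if "l \<notin> J" for l using u(2) J that by auto
    qed
    then show ?thesis by (simp add: fun_upd_comp)
  qed
  have bound: "Re (pdiff j f (of_real \<circ> u) / f (of_real \<circ> u)) \<le> \<phi>"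
    by (rule barrierD(2)[OF b u J(1)])
  have j0: "j \<noteq> 0" using J by metis
  show "one_minus_partial j f (of_real \<circ> w') \<noteq> 0"
    unfolding w'_eq by (rule barrier_shift_nonzero[OF f j0 k \<delta> above1 bound cond])
  fix i assume i: "i \<in> J - {j}"
  have "f (of_real \<circ> u(i := s, j := t)) \<noteq> 0" if "s \<ge> u i" "t \<ge> u j" for s t
  proof (rule barrierD(1)[OF b])
    show "w l \<le> (u(i := s, j := t)) l" for l using u(1)[of l] u(1)[of i] u(1)[of j] that by auto
    show "(u(i := s, j := t)) l = w l" if "l \<notin> J" for l using u(2) J i that by auto
  qed
  moreover have "i \<noteq> 0" "i \<noteq> j" using J i by (metis DiffD1, blast)
  ultimately have "Re (pdiff i (one_minus_partial j f) (of_real \<circ> w') / one_minus_partial j f (of_real \<circ> w'))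
      \<le> Re (pdiff i f (of_real \<circ> u) / f (of_real \<circ> u))"
    unfolding w'_eq using j0 by (intro barrier_shift_le[OF f _ _ _ k \<delta> _ bound cond]) auto
  also have "\<dots> \<le> \<phi>" using barrierD(2)[OF b u] i by blast
  finally show "Re (pdiff i (one_minus_partial j f) (of_real \<circ> w') / one_minus_partial j f (of_real \<circ> w')) \<le> \<phi>" .
qed

lemma stable_poly_foldr:
  assumes "stable_poly K f" "0 \<notin> set js"
  shows "stable_poly K (foldr one_minus_partial js f)"
  using assms by (induction js) (auto intro: stable_poly_one_minus_partial)

lemma barrier_foldr:
  assumes f: "stable_poly K f" and b: "barrier J \<phi> f w" and J: "0 \<notin> J"
    and js: "set js \<subseteq> J" "distinct js"
    and k: "k \<ge> 2" "\<And>j. j \<in> J \<Longrightarrow> K j \<le> k" and \<delta>: "\<delta> > 0"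
    and cond: "\<phi> / (1 + \<delta> * \<phi> / (real k - 1)) \<le> 1 - 1 / \<delta>"
  shows "barrier (J - set js) \<phi> (foldr one_minus_partial js f) (\<lambda>l. if l \<in> set js then w l + \<delta> else w l)"
  using js
proof (induction js)
  case Nil
  then show ?case using b by simp
next
  case (Cons j js)
  let ?w = "\<lambda>js l. if l \<in> set js then w l + \<delta> else w l"
  have "barrier (J - set js) \<phi> (foldr one_minus_partial js f) (?w js)"
    using Cons by simp
  then have "barrier (J - set js - {j}) \<phi> (one_minus_partial j (foldr one_minus_partial js f))
      ((?w js)(j := ?w js j + \<delta>))"
    using Cons.prems J k \<delta> cond
    by (intro barrier_step[OF stable_poly_foldr[OF f]]) auto
  moreover have "(?w js)(j := ?w js j + \<delta>) = ?w (j # js)" using Cons.prems by auto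
  moreover have "J - set js - {j} = J - set (j # js)" by auto
  ultimately show ?case by simp
qed

text \<open>Fixing z_0 = x commutes with the operators of index at least 1, so x may be substituted
  after applying them.\<close>

lemma mixed_char_poly_eq:
  "mixed_char_poly m X x = foldr one_minus_partial [1..<Suc m] (\<lambda>z. det (pencil m X z)) ((\<lambda>_. 0)(0 := x))"
proof -
  have *: "foldr one_minus_partial js (\<lambda>z. F (z(0 := x))) z = foldr one_minus_partial js F (z(0 := x))"
    if "0 \<notin> set js" for js F z
    using that
  proof (induction js arbitrary: z)
    case (Cons j js)
    then have "foldr one_minus_partial js (\<lambda>z. F (z(0 := x))) = (\<lambda>z. foldr one_minus_partial js F (z(0 := x)))"
      by (intro ext Cons.IH) auto
    moreover have "one_minus_partial j (\<lambda>z. H (z(0 := x))) z = one_minus_partial j H (z(0 := x))" for H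
      using Cons.prems by (simp add: one_minus_partial_def fun_upd_twist)
    ultimately show ?case by (simp only: foldr_Cons comp_apply)
  qed simp
  have "(\<lambda>z. det (mat x + (\<Sum>i=1..m. \<chi> a b. z i * X i $ a $ b))) = (\<lambda>z. det (pencil m X (z(0 := x))))"
    by (simp add: pencil_def)
  then show ?thesis unfolding mixed_char_poly_def
    by (simp only: *[of "[1..<Suc m]" "\<lambda>z. det (pencil m X z)"] set_upt atLeastLessThan_iff
        not_one_le_zero simp_thms)
qed

text \<open>\<open>maxroot\<close> is a \<open>Max\<close>, which is informative only for a finite
  nonempty set. A root exists since the polynomial is monic of degree d > 0; stability and
  conjugation symmetry make it real.\<close>

lemma real_roots_mixed_char_poly:
  fixes X :: "nat \<Rightarrow> complex^'n^'n"
  assumes psd: "\<And>i. i \<in> {1..m} \<Longrightarrow> psd_matrix (X i)"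
  shows "finite {r::real. mixed_char_poly m X (of_real r) = 0}"
    "{r::real. mixed_char_poly m X (of_real r) = 0} \<noteq> {}"
proof -
  define js where "js = [1..<Suc m]"
  define G where "G = foldr one_minus_partial js (\<lambda>z. det (pencil m X z))"
  define d where "d = CARD('n)"
  have G_eq: "mixed_char_poly m X t = G ((\<lambda>_. 0)(0 := t))" for t
    unfolding mixed_char_poly_eq G_def js_def ..
  have d: "d > 0" by (simp add: d_def)
  have js: "0 \<notin> set js" by (simp add: js_def)
  note stable = stable_poly_det_pencil[OF psd]
  have G: "stable_poly (rank_bound m X) G"
    unfolding G_def by (rule stable_poly_foldr[OF stable js])
  \<comment> \<open>The induction carries the difference to z_0^d, since this monomial is unchanged
    by the operators of index at least 1.\<close>
  have "poly_in 0 (d - 1) (\<lambda>z. foldr one_minus_partial js (\<lambda>z. det (pencil m X z)) z - z 0 ^ d)"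
    using js
  proof (induction js)
    case Nil
    then show ?case using det_pencil_monic[of m X] by (simp add: d_def)
  next
    case (Cons j js)
    let ?F = "foldr one_minus_partial js (\<lambda>z. det (pencil m X z))"
    have F: "stable_poly (rank_bound m X) ?F" using Cons.prems by (intro stable_poly_foldr[OF stable]) auto
    have j: "j \<noteq> 0" using Cons.prems by auto
    have der: "((\<lambda>t. ?F (z(j := t)) - (z(j := t)) 0 ^ d) has_field_derivative pdiff j ?F z) (at (z j))" for z
      using poly_in_DERIV[OF stable_polyD(1)[OF F, of j], of z] j by (auto intro!: derivative_eq_intros)
    have pd: "pdiff j (\<lambda>z. ?F z - z 0 ^ d) z = pdiff j ?F z" for z
      unfolding pdiff_def[of j "\<lambda>z. ?F z - z 0 ^ d"] by (rule DERIV_imp_deriv[OF der])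
    have IH: "poly_in 0 (d - 1) (\<lambda>z. ?F z - z 0 ^ d)" using Cons by auto
    have pj: "poly_in j (rank_bound m X j) (\<lambda>z. ?F z - z 0 ^ d)"
      unfolding poly_in_def
    proof
      fix z
      obtain p where "degree p \<le> rank_bound m X j" "\<And>t. ?F (z(j := t)) = poly p t"
        using poly_inE[OF stable_polyD(1)[OF F, of j]] by metis
      then show "\<exists>p. degree p \<le> rank_bound m X j \<and> (\<forall>t. ?F (z(j := t)) - (z(j := t)) 0 ^ d = poly p t)"
        using j by (intro exI[of _ "p - [:z 0 ^ d:]"]) (auto intro: degree_diff_le)
    qed
    have "poly_in 0 (d - 1) (one_minus_partial j (\<lambda>z. ?F z - z 0 ^ d))"
      by (rule poly_in_one_minus_partial[OF IH pj])
    moreover have "one_minus_partial j (\<lambda>z. ?F z - z 0 ^ d) = (\<lambda>z. one_minus_partial j ?F z - z 0 ^ d)"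
      using pd by (simp add: one_minus_partial_eq fun_eq_iff)
    ultimately show ?case by simp
  qed
  then obtain q where q: "degree q \<le> d - 1"
    "\<And>t. G (((\<lambda>_. 0)(0 := t))) - t ^ d = poly q t"
    unfolding poly_in_def G_def by (metis fun_upd_same)
  define p where "p = monom 1 d + q"
  have p: "mixed_char_poly m X t = poly p t" for t
    using q(2)[of t] unfolding G_eq p_def by (simp add: poly_monom algebra_simps)
  have "degree p = d"
    unfolding p_def using q(1) d by (subst degree_add_eq_left) (auto simp: degree_monom_eq)
  then have "p \<noteq> 0" "\<not> constant (poly p)" using d by (auto simp: constant_degree)
  then obtain x where x: "poly p x = 0" using fundamental_theorem_of_algebra by blast
  have nz: "mixed_char_poly m X y \<noteq> 0" if "Im y > 0" for y
    unfolding G_eq using stable_polyD(3)[OF G, of "(\<lambda>_. 0)(0 := y)"] that by simp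
  have "mixed_char_poly m X (cnj x) = 0"
  proof -
    have "cnj \<circ> (\<lambda>_::nat. 0)(0 := x) = (\<lambda>_. 0)(0 := cnj x)" by auto
    then show ?thesis
      using stable_polyD(2)[OF G, of "(\<lambda>_. 0)(0 := x)"] x unfolding p[symmetric] G_eq
      by simp
  qed
  then have "Im x = 0" using nz[of x] nz[of "cnj x"] x p by (cases "Im x" "0::real" rule: linorder_cases) auto
  then have "x = of_real (Re x)" by (simp add: complex_eq_iff)
  then show "{r::real. mixed_char_poly m X (of_real r) = 0} \<noteq> {}"
    using x unfolding p[symmetric] by (metis (mono_tags, lifting) empty_iff mem_Collect_eq)
  have "{r::real. mixed_char_poly m X (of_real r) = 0} \<subseteq> Re ` {z. poly p z = 0}" using p by force
  then show "finite {r::real. mixed_char_poly m X (of_real r) = 0}"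
    using poly_roots_finite[OF \<open>p \<noteq> 0\<close>] finite_surj by blast
qed

section \<open>Bounding the largest root\<close>

lemma trace_psd_nonneg:
  fixes A :: "complex^'n^'n"
  assumes "psd_matrix A"
  shows "Re (trace A) \<ge> 0"
proof -
  have "qform A (axis k 1) = A $ k $ k" for k
  proof -
    have "qform A (axis k 1) = (\<Sum>i\<in>UNIV. if i = k then A $ i $ k else 0)"
      unfolding qform_def by (intro sum.cong) (auto simp: axis_def matrix_vector_mult_def if_distrib cong: if_cong)
    then show ?thesis by simp
  qed
  then have "Re (A $ k $ k) \<ge> 0" for k using psd_matrix_qform(1)[OF assms] by metis
  then show ?thesis unfolding trace_def by (simp add: sum_nonneg)
qed

text \<open>The initial barrier. Above the starting point the pencil is t I + P with P positive
  semidefinite, so \<open>psd_logderiv_le\<close> bounds each barrier by tr(X_i) / t.\<close>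

lemma barrier_det_pencil:
  assumes psd: "\<And>i. i \<in> {1..m} \<Longrightarrow> psd_matrix (X i)"
    and le: "(\<Sum>i=1..m. X i) \<preceq>\<^sub>L mat 1"
    and tr: "\<And>i. i \<in> {1..m} \<Longrightarrow> Re (trace (X i)) \<le> \<epsilon>"
    and t: "t > 0" and \<delta>: "\<delta> \<ge> 0"
  shows "barrier {1..m} (\<epsilon> / t) (\<lambda>z. det (pencil m X z)) (\<lambda>l. if l = 0 then t + \<delta> else if l \<le> m then - \<delta> else 0)"
  unfolding barrier_def
proof (intro allI impI)
  let ?w = "\<lambda>l. if l = 0 then t + \<delta> else if l \<le> m then - \<delta> else 0"
  fix w assume w: "\<forall>l. ?w l \<le> w l" "\<forall>l. l \<notin> {1..m} \<longrightarrow> w l = ?w l"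
  define M where "M = pencil m X (of_real \<circ> w)"
  \<comment> \<open>The part \<delta> (I - sum X_i) is semidefinite by the Loewner hypothesis; it
    absorbs the offset \<delta> in z_0 and the starting values - \<delta>.\<close>
  define P where "P = (\<chi> a b. of_real \<delta> * (mat 1 - (\<Sum>i=1..m. X i)) $ a $ b)
    + (\<Sum>i=1..m. \<chi> a b. of_real (w i + \<delta>) * X i $ a $ b)"
  have "psd_matrix P"
    unfolding P_def
  proof (intro psd_matrix_add psd_matrix_scale psd_matrix_sum psd \<delta>)
    show "psd_matrix (mat 1 - (\<Sum>i=1..m. X i))" using le by (simp add: loewner_le_def)
    show "0 \<le> w i + \<delta>" if "i \<in> {1..m}" for i using w(1)[rule_format, of i] that by auto
  qed
  have w0: "w 0 = t + \<delta>" using w(2)[rule_format, of 0] by simp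
  have M: "M = mat (of_real t) + P"
    unfolding M_def P_def
    by (simp add: vec_eq_iff pencil_nth mat_def w0 sum.distrib distrib_right sum_distrib_left algebra_simps)
  have "det M \<noteq> 0"
  proof (rule det_nonzero_if_qform_nonzero)
    fix v :: "complex^'a" assume "v \<noteq> 0"
    then have "Re (qform M v) > 0"
      using t psd_matrix_qform(1)[OF \<open>psd_matrix P\<close>, of v] sum_norm_squares_pos[of v]
      by (simp add: M qform_linear qform_mat add_pos_nonneg)
    then show "qform M v \<noteq> 0" by auto
  qed
  moreover have "Re (pdiff i (\<lambda>z. det (pencil m X z)) (of_real \<circ> w) / det M) \<le> \<epsilon> / t"
    if i: "i \<in> {1..m}" for i
  proof -
    have "pdiff i (\<lambda>z. det (pencil m X z)) (of_real \<circ> w)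
        = deriv (\<lambda>s. det (mat (of_real t) + P + (\<chi> a b. (s - of_real (w i)) * X i $ a $ b))) (of_real (w i))"
      unfolding pdiff_def pencil_upd[OF i] M_def[symmetric] M[symmetric] by simp
    then have "Re (pdiff i (\<lambda>z. det (pencil m X z)) (of_real \<circ> w) / det M) \<le> Re (trace (X i)) / t"
      using psd_logderiv_le[OF \<open>psd_matrix P\<close> psd[OF i] t, of "of_real (w i)"] by (simp add: M)
    also have "\<dots> \<le> \<epsilon> / t" using tr[OF i] t by (simp add: divide_right_mono)
    finally show ?thesis .
  qed
  ultimately show "det (pencil m X (of_real \<circ> w)) \<noteq> 0 \<and>
      (\<forall>i\<in>{1..m}. Re (pdiff i (\<lambda>z. det (pencil m X z)) (of_real \<circ> w) / det (pencil m X (of_real \<circ> w))) \<le> \<epsilon> / t)"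
    by (simp add: M_def)
qed

text \<open>The m shifts by \<delta> carry z_i from - \<delta> to 0 while z_0 stays at t + \<delta>
  = x, so the final barrier states nonvanishing exactly at the evaluation point.\<close>

lemma mixed_char_poly_nonzero:
  fixes X :: "nat \<Rightarrow> complex^'n^'n"
  assumes k: "k \<ge> 2" and m: "m \<ge> 1"
    and psd: "\<And>i. i \<in> {1..m} \<Longrightarrow> psd_matrix (X i)"
    and rank: "\<And>i. i \<in> {1..m} \<Longrightarrow> rank (X i) \<le> k"
    and le: "(\<Sum>i=1..m. X i) \<preceq>\<^sub>L mat 1"
    and tr: "\<And>i. i \<in> {1..m} \<Longrightarrow> Re (trace (X i)) \<le> \<epsilon>"
    and u: "0 < u" "u < real k - 1"
    and x: "(1 + u) * (\<epsilon> / u + (1 - \<epsilon> / (real k - 1))) < x"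
  shows "mixed_char_poly m X (of_real x) \<noteq> 0"
proof -
  define \<delta> where "\<delta> = 1 + u"
  define t where "t = x - \<delta>"
  have \<delta>: "\<delta> > 0" using u by (simp add: \<delta>_def)
  have \<epsilon>: "\<epsilon> \<ge> 0" using trace_psd_nonneg[OF psd, of 1] tr[of 1] m by simp
  have "\<epsilon> / (real k - 1) \<le> \<epsilon> / u" using \<epsilon> u by (intro divide_left_mono) auto
  \<comment> \<open>The hypothesis on x after subtracting \<delta>; the right-hand side is
    nonnegative because u < k - 1.\<close>
  have t_gt: "t > \<delta> * (\<epsilon> / u - \<epsilon> / (real k - 1))"
    using x by (simp add: t_def \<delta>_def algebra_simps)
  moreover have "\<delta> * (\<epsilon> / u - \<epsilon> / (real k - 1)) \<ge> 0"
    using \<delta> \<open>\<epsilon> / (real k - 1) \<le> \<epsilon> / u\<close> by simp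
  ultimately have t: "t > 0" by linarith
  \<comment> \<open>With \<phi> = \<epsilon> / t the left side is \<epsilon> / (t + \<delta>
    \<epsilon> / (k - 1)) and the right side is u / \<delta>; the inequality follows from the lower
    bound \<open>t_gt\<close> on t.\<close>
  have cond: "\<epsilon> / t / (1 + \<delta> * (\<epsilon> / t) / (real k - 1)) \<le> 1 - 1 / \<delta>"
  proof -
    define s where "s = t + \<delta> * \<epsilon> / (real k - 1)"
    have s: "s > 0" unfolding s_def using t \<delta> \<epsilon> u by (intro add_pos_nonneg) auto
    have "1 + \<delta> * (\<epsilon> / t) / (real k - 1) = s / t"
      unfolding s_def add_divide_distrib using t by simp
    then have "\<epsilon> / t / (1 + \<delta> * (\<epsilon> / t) / (real k - 1)) = \<epsilon> / s" using t by simp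
    also have "\<dots> \<le> u / \<delta>"
    proof -
      have "\<delta> * \<epsilon> / u < s" using t_gt by (simp add: s_def algebra_simps)
      then have "\<epsilon> * \<delta> \<le> u * s" using u by (simp add: field_simps)
      then show ?thesis using s \<delta> by (simp add: field_simps)
    qed
    also have "u / \<delta> = 1 - 1 / \<delta>" using \<delta> by (simp add: \<delta>_def field_simps)
    finally show ?thesis .
  qed
  let ?w = "\<lambda>l. if l = 0 then t + \<delta> else if l \<le> m then - \<delta> else 0"
  let ?w1 = "\<lambda>l. if l \<in> set [1..<Suc m] then ?w l + \<delta> else ?w l"
  let ?G = "foldr one_minus_partial [1..<Suc m] (\<lambda>z. det (pencil m X z))"
  have base: "barrier {1..m} (\<epsilon> / t) (\<lambda>z. det (pencil m X z)) ?w"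
    using barrier_det_pencil[OF psd le tr t] \<delta> by simp
  have "barrier ({1..m} - set [1..<Suc m]) (\<epsilon> / t) ?G ?w1"
  proof (rule barrier_foldr[OF _ base _ _ _ k _ \<delta> cond])
    show "stable_poly (rank_bound m X) (\<lambda>z. det (pencil m X z))"
      using psd by (rule stable_poly_det_pencil)
    show "rank_bound m X j \<le> k" if "j \<in> {1..m}" for j
      using rank[OF that] that by (simp add: rank_bound_def)
  qed auto
  then have "?G (of_real \<circ> ?w1) \<noteq> 0" by (rule barrierD(1)) auto
  moreover have "complex_of_real \<circ> ?w1 = (\<lambda>_. 0)(0 := of_real x)" by (auto simp: t_def)
  ultimately show ?thesis unfolding mixed_char_poly_eq by metis
qed

text \<open>With c = 1 - \<epsilon> / (k - 1), the bound is \<epsilon> + c + \<epsilon> / u + c u,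
  minimal at u = sqrt (\<epsilon> / c). The hypothesis on \<epsilon> says precisely that this point
  is at most k - 1.\<close>

lemma optimize_shift:
  fixes r \<epsilon> :: real
  assumes k: "k \<ge> 2" and \<epsilon>: "\<epsilon> \<ge> 0" "\<epsilon> \<le> (real k - 1)\<^sup>2 / real k"
    and r: "\<And>u. \<lbrakk>0 < u; u < real k - 1\<rbrakk> \<Longrightarrow> r \<le> (1 + u) * (\<epsilon> / u + (1 - \<epsilon> / (real k - 1)))"
  shows "r \<le> (sqrt (1 - \<epsilon> / (real k - 1)) + sqrt \<epsilon>)\<^sup>2"
proof -
  define c where "c = 1 - \<epsilon> / (real k - 1)"
  have ek: "\<epsilon> * real k \<le> (real k - 1)\<^sup>2" using \<epsilon>(2) k by (simp add: field_simps)
  have c_eq: "c * (real k - 1) = real k - 1 - \<epsilon>" using k by (simp add: c_def field_simps)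
  have "real k * (real k - 1 - \<epsilon>) \<ge> real k * (real k - 1) - (real k - 1)\<^sup>2"
    using ek by (simp add: algebra_simps)
  also have "real k * (real k - 1) - (real k - 1)\<^sup>2 = real k - 1" by (simp add: power2_eq_square algebra_simps)
  finally have "real k * (c * (real k - 1)) > 0" using k c_eq by simp
  then have c: "c > 0" using k by (simp add: zero_less_mult_iff)
  show ?thesis
  proof (cases "\<epsilon> = 0")
    \<comment> \<open>The minimum would be at u = 0, outside the admissible range, so u tends to 0
      instead; the cap 1 / 2 keeps u below k - 1.\<close>
    case True
    have "r \<le> 1"
    proof (rule field_le_epsilon)
      fix e :: real assume e: "e > 0"
      define u where "u = min e (1 / 2)"
      have "r \<le> 1 + u" using r[of u] e k True by (simp add: u_def)
      then show "r \<le> 1 + e" by (simp add: u_def)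
    qed
    then show ?thesis using True by simp
  next
    case False
    define u0 where "u0 = sqrt (\<epsilon> / c)"
    have u0: "u0 > 0" using \<epsilon> False c by (simp add: u0_def)
    have "\<epsilon> \<le> c * (real k - 1) * (real k - 1)"
      using ek unfolding c_eq by (simp add: power2_eq_square algebra_simps)
    then have "\<epsilon> / c \<le> (real k - 1)\<^sup>2" using c by (simp add: field_simps power2_eq_square)
    then have "u0 \<le> real k - 1" unfolding u0_def using k by (intro real_le_lsqrt) auto
    \<comment> \<open>The minimizer may equal the excluded endpoint k - 1, hence the limit from the
      left.\<close>
    have lim: "((\<lambda>u. (1 + u) * (\<epsilon> / u + c)) \<longlongrightarrow> (1 + u0) * (\<epsilon> / u0 + c)) (at_left u0)"
      using u0 by (intro tendsto_intros) auto
    have "\<forall>\<^sub>F u in at_left u0. r \<le> (1 + u) * (\<epsilon> / u + c)"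
      using eventually_at_left_real[OF u0]
      by eventually_elim (use r \<open>u0 \<le> real k - 1\<close> in \<open>auto simp: c_def\<close>)
    then have "r \<le> (1 + u0) * (\<epsilon> / u0 + c)" by (intro tendsto_lowerbound[OF lim]) auto
    also have "\<dots> = (sqrt c + sqrt \<epsilon>)\<^sup>2"
    proof -
      define p q where "p = sqrt c" and "q = sqrt \<epsilon>"
      have pq: "p > 0" "q > 0" "c = p\<^sup>2" "\<epsilon> = q\<^sup>2" using c \<epsilon> False by (auto simp: p_def q_def)
      have "u0 = q / p" by (simp add: u0_def p_def q_def real_sqrt_divide)
      moreover have "(1 + q / p) * (q\<^sup>2 / (q / p) + p\<^sup>2) = (p + q)\<^sup>2"
        using pq(1,2) by (simp add: field_simps power2_eq_square)
      ultimately show ?thesis unfolding p_def[symmetric] q_def[symmetric] using pq(3,4) by simp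
    qed
    finally show ?thesis by (simp add: c_def)
  qed
qed

theorem theorem1p9:
  fixes k m :: nat
    and X :: "nat \<Rightarrow> complex^'d^'d"
    and \<epsilon> :: real
  assumes "k \<ge> 2"
    and "m \<ge> 1"
    and "\<And>i. i \<in> {1..m} \<Longrightarrow> psd_matrix (X i)"
    and "\<And>i. i \<in> {1..m} \<Longrightarrow> rank (X i) \<le> k"
    and "(\<Sum>i=1..m. X i) \<preceq>\<^sub>L mat 1"
    and "\<epsilon> = Max ((\<lambda>i. Re (trace (X i))) ` {1..m})"
    and "\<epsilon> \<le> (real k - 1)\<^sup>2 / real k"
  shows "maxroot (mixed_char_poly m X)
           \<le> (sqrt (1 - \<epsilon> / (real k - 1)) + sqrt \<epsilon>)\<^sup>2"
proof -
  have tr: "Re (trace (X i)) \<le> \<epsilon>" if "i \<in> {1..m}" for i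
    unfolding assms(6) using that by (intro Max_ge) auto
  have \<epsilon>: "\<epsilon> \<ge> 0" using trace_psd_nonneg[OF assms(3), of 1] tr[of 1] assms(2) by simp
  have "r \<le> (sqrt (1 - \<epsilon> / (real k - 1)) + sqrt \<epsilon>)\<^sup>2" if "mixed_char_poly m X (of_real r) = 0" for r
  proof (rule optimize_shift[OF assms(1) \<epsilon> assms(7)])
    fix u :: real assume "0 < u" "u < real k - 1"
    then show "r \<le> (1 + u) * (\<epsilon> / u + (1 - \<epsilon> / (real k - 1)))"
      using mixed_char_poly_nonzero[OF assms(1-5) tr, of u r] that by force
  qed
  then show ?thesis
    unfolding maxroot_def using real_roots_mixed_char_poly[of m X] assms(3) by (intro Max.boundedI) auto
qed

end
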